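(* Let $k\ge 0$ and $n\ge (k+2)^2$ be integers, and let $G$ be a balanced bipartite graph on $2n$ vertices with minimum degree $\delta(G)\ge k$. If $q(G)\ge q(Q_n^k)$, then $G$ is traceable unless $G=Q_n^k$.
   Context: Graphs are finite and simple. A bipartite graph comes with a fixed bipartition $\{X,Y\}$ (parts may be empty); it is balanced if $|X|=|Y|$. A graph is traceable if it contains a spanning path (Hamilton path). $q(G)$ is the signless Laplacian spectral radius, i.e. the largest eigenvalue of $D(G)+A(G)$, where $A(G)$ is the adjacency matrix and $D(G)$ the diagonal degree matrix. Equality of graphs is up to isomorphism. $K_{m,n}$ is the complete bipartite graph with parts of sizes $|X|=m$, $|Y|=n$, and $\varPhi_{m,n}$ is the edgeless bipartite graph with parts of sizes $|X|=m$, $|Y|=n$. For bipartite graphs $G_1,G_2$ with bipartitions $\{X_1,Y_1\}$, $\{X_2,Y_2\}$, $G_1\sqcup G_2$ is the graph obtained from the disjoint union $G_1\cup G_2$ by adding all edges between $X_1$ and $Y_2$ and all edges between $Y_1$ and $X_2$ (its parts are $X_1\cup X_2$ and $Y_1\cup Y_2$). Define $Q_n^k=K_{k,n-k-1}\sqcup\varPhi_{n-k,k+1}$ for $0\le k\le (n-1)/2$. *)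

theory Defs
  imports
    "Graph_Theory.Pair_Digraph"
    "Graph_Theory.Vertex_Walk"
    "Graph_Theory.Digraph_Isomorphism"
    "Jordan_Normal_Form.Char_Poly"
begin

text \<open>
  A finite simple graph is, as in \<^theory>\<open>Graph_Theory.Digraph\<close>, a finite symmetric digraph without
  loops and parallel arcs (locale \<^locale>\<open>graph\<close>): an edge \<open>uv\<close> is the pair of arcs
  \<open>(u, v)\<close>, \<open>(v, u)\<close>, so the degree of a vertex is its \<^const>\<open>out_degree\<close>, and
  \<^const>\<open>digraph_iso\<close> is graph isomorphism.
\<close>

definition min_degree :: "('a, 'b) pre_digraph \<Rightarrow> nat" where
  "min_degree G = Min (out_degree G ` verts G)"

definition traceable :: "('a, 'b) pre_digraph \<Rightarrow> bool" where
  "traceable G \<longleftrightarrow> (\<exists>p. vpath p G \<and> set p = verts G)"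

text \<open>The matrices are indexed by positions in an enumeration \<open>vs\<close> of the vertex set.\<close>

definition adjacency_matrix :: "('a, 'b) pre_digraph \<Rightarrow> 'a list \<Rightarrow> real mat" where
  "adjacency_matrix G vs =
     mat (length vs) (length vs) (\<lambda>(i, j). if vs ! i \<rightarrow>\<^bsub>G\<^esub> vs ! j then 1 else 0)"

definition degree_matrix :: "('a, 'b) pre_digraph \<Rightarrow> 'a list \<Rightarrow> real mat" where
  "degree_matrix G vs =
     mat (length vs) (length vs) (\<lambda>(i, j). if i = j then real (out_degree G (vs ! i)) else 0)"

definition signless_laplacian :: "('a, 'b) pre_digraph \<Rightarrow> 'a list \<Rightarrow> real mat" where
  "signless_laplacian G vs = degree_matrix G vs + adjacency_matrix G vs"

definition vertex_list :: "('a, 'b) pre_digraph \<Rightarrow> 'a list" where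
  "vertex_list G = (SOME vs. distinct vs \<and> set vs = verts G)"

text \<open>
  Another enumeration conjugates the matrix by a permutation matrix, so the arbitrary choice in
  \<^const>\<open>vertex_list\<close> does not affect the eigenvalues. They are all real, as the matrix is symmetric.
\<close>

definition signless_spectral_radius :: "('a, 'b) pre_digraph \<Rightarrow> real" where
  "signless_spectral_radius G = Max {\<mu>. eigenvalue (signless_laplacian G (vertex_list G)) \<mu>}"

text \<open>
  A bipartite graph together with its bipartition. Each edge is recorded once, oriented from the
  first part to the second.
\<close>

record 'a bigraph =
  part_X :: "'a set"
  part_Y :: "'a set"
  edges_XY :: "('a \<times> 'a) set"

definition bipartite_graph :: "'a bigraph \<Rightarrow> bool" where
  "bipartite_graph B \<longleftrightarrow> finite (part_X B) \<and> finite (part_Y B) \<and> part_X B \<inter> part_Y B = {} \<and>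
     edges_XY B \<subseteq> part_X B \<times> part_Y B"

definition balanced :: "'a bigraph \<Rightarrow> bool" where
  "balanced B \<longleftrightarrow> card (part_X B) = card (part_Y B)"

definition graph_of :: "'a bigraph \<Rightarrow> ('a, 'a \<times> 'a) pre_digraph" where
  "graph_of B =
     with_proj \<lparr> pverts = part_X B \<union> part_Y B, parcs = edges_XY B \<union> (edges_XY B)\<inverse> \<rparr>"

lemma graph_graph_of:
  assumes "bipartite_graph B"
  shows "graph (graph_of B)"
proof -
  let ?P = "\<lparr> pverts = part_X B \<union> part_Y B, parcs = edges_XY B \<union> (edges_XY B)\<inverse> \<rparr>"
  have "finite (edges_XY B)"
    using assms unfolding bipartite_graph_def by (meson finite_SigmaI finite_subset)
  with assms have "pair_graph ?P"
    by unfold_locales (auto simp: bipartite_graph_def symmetric_def sym_def)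
  then interpret pair_graph ?P .
  show ?thesis
    unfolding graph_of_def by unfold_locales
qed

definition complete_bigraph :: "nat \<Rightarrow> nat \<Rightarrow> (nat + nat) bigraph" where
  "complete_bigraph m n =
     \<lparr> part_X = Inl ` {..<m}, part_Y = Inr ` {..<n}, edges_XY = Inl ` {..<m} \<times> Inr ` {..<n} \<rparr>"

definition edgeless_bigraph :: "nat \<Rightarrow> nat \<Rightarrow> (nat + nat) bigraph" where
  "edgeless_bigraph m n =
     \<lparr> part_X = Inl ` {..<m}, part_Y = Inr ` {..<n}, edges_XY = {} \<rparr>"

definition bijoin :: "'a bigraph \<Rightarrow> 'b bigraph \<Rightarrow> ('a + 'b) bigraph" (infixl \<open>\<squnion>\<^sub>b\<close> 65) where
  "B1 \<squnion>\<^sub>b B2 =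
     \<lparr> part_X = Inl ` part_X B1 \<union> Inr ` part_X B2,
       part_Y = Inl ` part_Y B1 \<union> Inr ` part_Y B2,
       edges_XY = map_prod Inl Inl ` edges_XY B1 \<union> map_prod Inr Inr ` edges_XY B2
         \<union> Inl ` part_X B1 \<times> Inr ` part_Y B2 \<union> Inr ` part_X B2 \<times> Inl ` part_Y B1 \<rparr>"

text \<open>Only meaningful for \<open>2 * k + 1 \<le> n\<close>, where the subtractions do not truncate.\<close>

definition Q_bigraph :: "nat \<Rightarrow> nat \<Rightarrow> ((nat + nat) + (nat + nat)) bigraph" where
  "Q_bigraph n k = complete_bigraph k (n - k - 1) \<squnion>\<^sub>b edgeless_bigraph (n - k) (k + 1)"

end

theory Submission
  imports Defs
begin

text \<open>
  A nontraceable balanced bipartite graph is enlarged to an edge-maximal one; there nonadjacent vertices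
  of different parts have degree sum at most \<open>n\<close> (Bondy--Chvatal). The spectral bound
  \<open>q(G) \<le> max (d(u) + m(u)) \<le> e(G) / n + n\<close>, \<open>m(u)\<close> being the mean degree of the neighbours of \<open>u\<close>,
  shows that at most \<open>n (k + 1)\<close> edges are missing, so every degree is at most \<open>k + 1\<close> or at least
  \<open>n - k - 1\<close>. Vertices of large degree in different parts are adjacent, and an analysis of the few
  vertices of small degree leaves \<open>G \<subseteq> Q\<close> for a copy \<open>Q\<close> of \<open>Q\<^sub>n\<^sup>k\<close>, or, for \<open>k = 1\<close>, two further shapes:
  all degrees below \<open>n\<close>, which forces \<open>q(G) \<le> 2 n - 2 < q(Q)\<close>, and two pendant vertices with distinct
  neighbours. Pairing \<open>\<bar>f\<bar>\<close>, for an eigenvector \<open>f\<close> of \<open>G\<close>, with an explicit positive eigenvector of \<open>Q\<close>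
  forces equality in the first case and excludes the last one.
\<close>

section \<open>Hamilton paths in dense balanced bipartite graphs\<close>

text \<open>The budget of \<open>n * (k + 1)\<close> missing edges comes from
  \<open>2 * n - k - 1\<close>, the radius of the subgraph \<open>K_{n,n-k-1}\<close> of Q. In an
  edge-maximal graph a vertex of degree \<open>d\<close> alone forces \<open>d * (n - d)\<close>
  missing edges, and for \<open>d = k + 2\<close> this reaches the budget exactly when
  \<open>n \<ge> (k + 2)\<^sup>2\<close>: hence the quadratic bound. Ties matter. For
  \<open>k \<ge> 1\<close> the radius of Q is strictly larger and the budget is never exhausted; for
  \<open>k = 0\<close> Q is \<open>K_{n,n-1}\<close> plus an isolated vertex, the budget may be met,
  and \<open>n = 4\<close>, \<open>d = 2\<close> has to be excluded by hand. The structural analysis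
  yields only inclusions of edge sets, which survive deleting edges and so descend from the maximal
  graph to \<open>G\<close>. Equality is recovered spectrally. As \<open>G\<close> may be
  disconnected, its eigenvector need not be positive and \<open>\<bar>f\<bar>\<close> satisfies just
  \<open>\<mu> * \<bar>f\<bar> \<le> lap E \<bar>f\<bar>\<close>; all positivity sits in the
  explicit eigenvector of Q, which takes the place of Perron-Frobenius. Its eigenvalue
  \<open>q\<close> is bounded above by q(Q), hence by q(G).\<close>

text \<open>Growing paths by two vertices at a time keeps them balanced and ending in the first part.\<close>

inductive zigzag :: "('a \<times> 'a) set \<Rightarrow> 'a list \<Rightarrow> bool" for E where
  Nil: "zigzag E []"
| snoc: "zigzag E p \<Longrightarrow> (x, y) \<in> E \<Longrightarrow> x \<notin> set p \<Longrightarrow> y \<notin> set p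
    \<Longrightarrow> p = [] \<or> (last p, y) \<in> E \<Longrightarrow> zigzag E (p @ [y, x])"

definition spanned :: "'a set \<Rightarrow> ('a \<times> 'a) set \<Rightarrow> bool" where
  "spanned V E \<longleftrightarrow> (\<exists>p. distinct p \<and> set p = V \<and> successively (\<lambda>u v. (u, v) \<in> E \<union> E\<inverse>) p)"

lemma spanned_converse [simp]: "spanned V (E\<inverse>) \<longleftrightarrow> spanned V E"
  by (simp add: spanned_def Un_commute)

text \<open>Each step ends in \<open>W\<close>, which is complete to \<open>S\<close>, so the path
  can go on greedily; the condition on \<open>last p\<close> attaches the first pair.\<close>

lemma zigzag_interleave:
  assumes "zigzag E p" "finite S" "card S = card W" "W \<times> S \<subseteq> E" "W \<inter> S = {}"
    and "(W \<union> S) \<inter> set p = {}" "finite W" "p = [] \<or> {last p} \<times> S \<subseteq> E"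
  shows "\<exists>q. zigzag E (p @ q) \<and> set q = W \<union> S \<and> (q \<noteq> [] \<longrightarrow> last q \<in> W)"
  using assms(2,1,3-)
proof (induction S arbitrary: p W rule: finite_induct)
  case empty
  then show ?case by (intro exI[of _ "[]"]) auto
next
  case (insert s S)
  then obtain w where w: "w \<in> W" by (metis card.empty card_insert_disjoint ex_in_conv nat.distinct(1))
  let ?p = "p @ [s, w]"
  have "\<exists>q. zigzag E (?p @ q) \<and> set q = (W - {w}) \<union> S \<and> (q \<noteq> [] \<longrightarrow> last q \<in> W - {w})"
  proof (rule insert.IH)
    show "zigzag E ?p"
      by (rule zigzag.snoc) (use insert.prems w in auto)
    show "card S = card (W - {w})" using insert w by auto
  qed (use insert.prems insert.hyps w in auto)
  then obtain q where "zigzag E (?p @ q)" "set q = (W - {w}) \<union> S" "q \<noteq> [] \<longrightarrow> last q \<in> W - {w}"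
    by auto
  with w show ?case by (intro exI[of _ "[s, w] @ q"]) auto
qed

text \<open>An inclusion, so that subgraphs inherit it. \<open>W\<close> is the cell of size
  \<open>k\<close> in the complete factor of Q, \<open>S\<close> the cell of size
  \<open>k + 1\<close> in the edgeless one.\<close>

definition Q_shape :: "nat \<Rightarrow> 'a set \<Rightarrow> 'a set \<Rightarrow> ('a \<times> 'a) set \<Rightarrow> bool" where
  "Q_shape k X Y E \<longleftrightarrow> (\<exists>W S. W \<subseteq> X \<and> S \<subseteq> Y \<and> card W = k \<and> card S = k + 1
     \<and> E \<subseteq> X \<times> (Y - S) \<union> W \<times> S)"

text \<open>The bounding graph is a copy of Q for \<open>k = 1\<close> with the edge
  \<open>p1 s2\<close> moved to \<open>p2 s2\<close>.\<close>

definition R_shape :: "'a set \<Rightarrow> 'a set \<Rightarrow> ('a \<times> 'a) set \<Rightarrow> bool" where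
  "R_shape X Y E \<longleftrightarrow> (\<exists>s1 s2 p1 p2. {s1, s2} \<subseteq> Y \<and> s1 \<noteq> s2 \<and> {p1, p2} \<subseteq> X \<and> p1 \<noteq> p2
     \<and> E \<subseteq> X \<times> (Y - {s1, s2}) \<union> {(p1, s1), (p2, s2)})"

lemma Q_shape_mono: "Q_shape k X Y F \<Longrightarrow> E \<subseteq> F \<Longrightarrow> Q_shape k X Y E"
  unfolding Q_shape_def by (elim ex_forward) auto

lemma R_shape_mono: "R_shape X Y F \<Longrightarrow> E \<subseteq> F \<Longrightarrow> R_shape X Y E"
  unfolding R_shape_def by (elim ex_forward) auto

text \<open>With \<open>d = k + 2 + i\<close> and \<open>n - d = k + 2 + j\<close>, the difference
  \<open>d * (n - d) - n * (k + 1)\<close> is \<open>i + j + i * j - k * (k + 2)\<close>, and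
  \<open>(k + 2)\<^sup>2 \<le> n\<close> says precisely that
  \<open>k * (k + 2) \<le> i + j\<close>.\<close>

lemma middle_degree_arith:
  fixes d k n :: nat
  assumes "(k + 2)\<^sup>2 \<le> n" "k + 2 \<le> d" "d + k + 2 \<le> n" 
  shows "n * (k + 1) \<le> d * (n - d)" and "k = 0 \<Longrightarrow> d * (n - d) \<le> n \<Longrightarrow> n = 4 \<and> d = 2"
proof -
  obtain i where i: "d = k + 2 + i" using assms(2) le_Suc_ex by blast
  have "\<exists>j. n = d + (k + 2) + j" using assms(3) le_Suc_ex[of "d + (k + 2)" n] by simp
  then obtain j where j: "n = d + (k + 2) + j" by blast
  have nd: "n - d = k + 2 + j" using j by simp
  have "k * k + 2 * k \<le> i + j" using assms(1) i j by (simp add: power2_eq_square algebra_simps)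
  then show "n * (k + 1) \<le> d * (n - d)" unfolding nd unfolding j i by (simp add: algebra_simps)
  assume "k = 0" "d * (n - d) \<le> n"
  then have "(2 + i) * (2 + j) \<le> 4 + i + j" unfolding nd unfolding j i by simp
  then have "i = 0 \<and> j = 0" by (simp add: algebra_simps)
  then show "n = 4 \<and> d = 2" using \<open>k = 0\<close> i j by simp
qed

locale balanced_parts =
  fixes X Y :: "'a set" and n :: nat
  assumes fin [simp]: "finite X" "finite Y" and disj: "X \<inter> Y = {}"
    and card_parts: "card X = n" "card Y = n"
begin

lemma swap: "balanced_parts Y X n"
  using disj card_parts by unfold_locales auto

lemma finite_edges: "E \<subseteq> X \<times> Y \<Longrightarrow> finite E"
  by (meson fin finite_SigmaI finite_subset)

lemma finite_nb: "E \<subseteq> X \<times> Y \<Longrightarrow> finite (E `` {x})" "E \<subseteq> X \<times> Y \<Longrightarrow> finite (E\<inverse> `` {y})"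
  using finite_edges by auto

lemma zigzag_props:
  assumes "zigzag E p" "E \<subseteq> X \<times> Y"
  shows "distinct p \<and> successively (\<lambda>u v. (u, v) \<in> E \<union> E\<inverse>) p \<and> set p \<subseteq> X \<union> Y
    \<and> (p \<noteq> [] \<longrightarrow> last p \<in> X) \<and> card (set p \<inter> X) = card (set p \<inter> Y)"
  using assms
proof induction
  case (snoc p x y)
  then have xy: "x \<in> X" "y \<in> Y" "x \<notin> Y" "y \<notin> X" using disj by auto
  then have "set (p @ [y, x]) \<inter> X = insert x (set p \<inter> X)" "set (p @ [y, x]) \<inter> Y = insert y (set p \<inter> Y)"
    by auto
  then show ?case using snoc xy by (auto simp: successively_append_iff)
qed simp

text \<open>A zigzag uses equally many vertices of both parts. Once it contains every deficient
  vertex of \<open>Y\<close>, the rest is balanced and complete bipartite, so it can be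
  appended.\<close>

lemma spanned_if_zigzag:
  assumes "zigzag E p" "E \<subseteq> X \<times> Y" "X \<times> (Y - set p) \<subseteq> E"
  shows "spanned (X \<union> Y) E"
proof -
  note P = zigzag_props[OF assms(1,2)]
  have "\<exists>q. zigzag E (p @ q) \<and> set q = (X - set p) \<union> (Y - set p) \<and> (q \<noteq> [] \<longrightarrow> last q \<in> X - set p)"
  proof (rule zigzag_interleave)
    show "card (Y - set p) = card (X - set p)"
      using P by (simp add: card_Diff_subset_Int card_parts Int_commute)
  qed (use assms P disj in auto)
  then obtain q where q: "zigzag E (p @ q)" "set q = (X - set p) \<union> (Y - set p)" by auto
  have "set (p @ q) = X \<union> Y" using q(2) P by auto
  then show ?thesis using zigzag_props[OF q(1) assms(2)] unfolding spanned_def by blast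
qed

section \<open>The Bondy-Chvatal degree condition for Hamilton paths\<close>

lemma card_nth_in:
  assumes "distinct p" "T \<subseteq> set p"
  shows "card {j. j < length p \<and> p ! j \<in> T} = card T"
proof -
  have "bij_betw ((!) p) {j. j < length p \<and> p ! j \<in> T} T"
    using assms by (auto simp: bij_betw_def inj_on_def distinct_conv_nth subset_iff in_set_conv_nth)
  then show ?thesis by (rule bij_betw_same_card)
qed

text \<open>A Hamilton path of the graph with \<open>uv\<close> added must use \<open>uv\<close>;
  cut it there into \<open>P\<close> and \<open>Q\<close>. If \<open>u\<close> is adjacent to the
  vertex at position \<open>j\<close> and \<open>v\<close> to the one at \<open>j + 1\<close>,
  reversing the segment between that gap and the edge \<open>uv\<close> gives a Hamilton path
  without \<open>uv\<close>. So the positions of neighbours of \<open>u\<close> and the positions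
  preceding neighbours of \<open>v\<close> are disjoint, and all of them are among the
  \<open>n\<close> positions occupied by \<open>Y\<close>.\<close>

lemma nonadjacent_degree_sum:
  assumes E: "E \<subseteq> X \<times> Y" and u: "u \<in> X" and v: "v \<in> Y"
    and ns: "\<not> spanned (X \<union> Y) E" and sp: "spanned (X \<union> Y) (insert (u, v) E)"
  shows "card (E `` {u}) + card (E\<inverse> `` {v}) \<le> n"
proof -
  let ?R = "\<lambda>a b. (a, b) \<in> E \<union> E\<inverse>"
  let ?R' = "\<lambda>a b. (a, b) \<in> insert (u, v) E \<union> (insert (u, v) E)\<inverse>"
  have sym: "?R a b \<longleftrightarrow> ?R b a" for a b by auto
  have R': "?R' a b \<Longrightarrow> ?R a b \<or> (a, b) = (u, v) \<or> (a, b) = (v, u)" for a b by auto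
  obtain p0 where p0: "distinct p0" "set p0 = X \<union> Y" "successively ?R' p0"
    using sp by (auto simp: spanned_def)
  have "\<not> successively ?R p0" using p0 ns unfolding spanned_def by blast
  then obtain i where i: "Suc i < length p0" "\<not> ?R (p0 ! i) (p0 ! Suc i)"
    unfolding successively_conv_nth by blast
  have "?R' (p0 ! i) (p0 ! Suc i)" using p0(3) i(1) by (rule successively_nth)
  then have ab: "(p0 ! i, p0 ! Suc i) = (u, v) \<or> (p0 ! i, p0 ! Suc i) = (v, u)" using i(2) R' by blast
  have p0_split: "p0 = take i p0 @ [p0 ! i, p0 ! Suc i] @ drop (Suc (Suc i)) p0"
    using i(1) by (metis Cons_nth_drop_Suc Suc_lessD append_Cons append_Nil append_take_drop_id)
  have "\<exists>ps qs. distinct (ps @ [u, v] @ qs) \<and> set (ps @ [u, v] @ qs) = X \<union> Y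
    \<and> successively ?R' (ps @ [u, v] @ qs)"
  proof (cases "p0 ! i = u \<and> p0 ! Suc i = v")
    case True
    then show ?thesis using p0 p0_split by metis
  next
    case False
    then have "p0 = take i p0 @ [v, u] @ drop (Suc (Suc i)) p0" using ab p0_split by auto
    then have "rev p0 = rev (drop (Suc (Suc i)) p0) @ [u, v] @ rev (take i p0)"
      by (metis append.assoc append_Cons append_Nil rev_append rev_singleton_conv rev.simps(2))
    moreover have "successively ?R' (rev p0)"
      by (subst successively_rev) (rule successively_mono[OF p0(3)], auto)
    ultimately show ?thesis using p0(1,2) by (metis distinct_rev set_rev)
  qed
  then obtain ps qs where pq: "distinct (ps @ [u, v] @ qs)" "set (ps @ [u, v] @ qs) = X \<union> Y"
    "successively ?R' (ps @ [u, v] @ qs)" by blast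
  define P where "P = ps @ [u]"
  define Q where "Q = v # qs"
  define p where "p = P @ Q"
  have p: "distinct p" "set p = X \<union> Y" "successively ?R' p" using pq by (auto simp: p_def P_def Q_def)
  have ends: "P \<noteq> []" "Q \<noteq> []" "last P = u" "hd Q = v" by (auto simp: P_def Q_def)
  have "successively ?R' P" "successively ?R' Q" using p(3) by (auto simp: p_def successively_append_iff)
  then have PQ: "successively ?R P" "successively ?R Q"
    using p(1) by (auto simp: p_def P_def Q_def elim!: successively_mono)
  have no: "\<not> (distinct r \<and> set r = set p \<and> successively ?R r)" for r
    using ns p(2) by (auto simp: spanned_def)
  have rev_R: "successively ?R (rev r) = successively ?R r" for r
    by (subst successively_rev) (simp add: sym disj_commute)
  \<comment> \<open>A neighbour of \<open>v\<close> at position 0 would have no predecessor and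
    escape the count.\<close>
  have hd_v: "\<not> ?R v (hd p)"
  proof
    assume "?R v (hd p)"
    then have "?R (last (rev P)) (hd Q)" using ends by (auto simp: last_rev p_def)
    then have "successively ?R (rev P @ Q)" using PQ rev_R by (simp add: successively_append_iff)
    then show False using no[of "rev P @ Q"] p(1) by (simp add: p_def)
  qed
  have cross: "\<not> (?R u (last A) \<and> ?R v (hd B))" if AB: "p = A @ B" "A \<noteq> []" "B \<noteq> []" for A B
  proof
    assume R: "?R u (last A) \<and> ?R v (hd B)"
    consider Q1 where "A = P @ Q1" "Q = Q1 @ B" | P1 where "P = A @ P1" "B = P1 @ Q"
      using AB(1) unfolding p_def by (auto simp: append_eq_append_conv2)
    then show False
    proof cases
      case 1
      have "Q1 \<noteq> []" using R 1 ends u disj E by auto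
      then have "successively ?R (P @ rev Q1 @ B)"
        using PQ rev_R R 1 ends AB(3) by (simp add: successively_append_iff last_rev hd_rev)
      then show False using no[of "P @ rev Q1 @ B"] p(1) 1 AB by auto
    next
      case 2
      have "P1 \<noteq> []" using R 2 ends v disj E by auto
      then have "successively ?R (A @ rev P1 @ Q)"
        using PQ rev_R R 2 ends AB(2) sym by (simp add: successively_append_iff last_rev hd_rev)
      then show False using no[of "A @ rev P1 @ Q"] p(1) 2 AB by auto
    qed
  qed
  let ?K = "{j. j < length p \<and> p ! j \<in> Y}"
  let ?I = "{j. j < length p \<and> p ! j \<in> E `` {u}}"
  let ?J = "{j. Suc j < length p \<and> p ! Suc j \<in> E\<inverse> `` {v}}"
  have sub: "E `` {u} \<subseteq> set p" "E\<inverse> `` {v} \<subseteq> set p" "Y \<subseteq> set p" using E p(2) by auto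
  have "Suc ` ?J = {j. j < length p \<and> p ! j \<in> E\<inverse> `` {v}}"
  proof -
    have "j \<in> Suc ` ?J" if "j < length p" "p ! j \<in> E\<inverse> `` {v}" for j
    proof -
      have "j \<noteq> 0" using that hd_v by (cases p; cases j) auto
      then show ?thesis using that by (cases j) auto
    qed
    then show ?thesis by auto
  qed
  then have "card (Suc ` ?J) = card (E\<inverse> `` {v})"
    using card_nth_in[OF p(1) sub(2)] by simp
  then have "card ?J = card (E\<inverse> `` {v})" by (simp add: card_image)
  moreover have "card ?I = card (E `` {u})" by (rule card_nth_in[OF p(1) sub(1)])
  moreover have "card ?K = n" using card_nth_in[OF p(1) sub(3)] card_parts by simp
  moreover have "?I \<inter> ?J = {}"
  proof -
    have False if "Suc j < length p" "p ! j \<in> E `` {u}" "p ! Suc j \<in> E\<inverse> `` {v}" for j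
    proof -
      have "last (take (Suc j) p) = p ! j" "hd (drop (Suc j) p) = p ! Suc j"
        using that(1) by (simp_all add: take_Suc_conv_app_nth hd_drop_conv_nth)
      moreover have "p \<noteq> []" using that(1) by auto
      ultimately show False
        using cross[of "take (Suc j) p" "drop (Suc j) p"] that by auto
    qed
    then show ?thesis by auto
  qed
  moreover have "?I \<union> ?J \<subseteq> ?K"
  proof -
    have "p ! j \<in> Y" if "Suc j < length p" "p ! Suc j \<in> E\<inverse> `` {v}" for j
      using successively_nth[OF p(3) that(1)] that E u v disj by auto
    then show ?thesis using E by auto
  qed
  moreover have "finite ?K" "finite ?I" "finite ?J" by (auto intro: finite_subset[of _ "{..<length p}"])
  ultimately show ?thesis using card_Un_disjoint[of ?I ?J] card_mono[of ?K "?I \<union> ?J"] by linarith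
qed

section \<open>All deficient vertices in one part\<close>

definition degree_closed :: "('a \<times> 'a) set \<Rightarrow> bool" where
  "degree_closed E \<longleftrightarrow> (\<forall>x\<in>X. \<forall>y\<in>Y. (x, y) \<notin> E \<longrightarrow> card (E `` {x}) + card (E\<inverse> `` {y}) \<le> n)"

text \<open>Each \<open>t\<close> in \<open>T\<close> enters as a block \<open>b, a, t, c\<close>,
  where \<open>a\<close> and \<open>c\<close> are private neighbours of \<open>t\<close> and the
  filler \<open>b\<close> from \<open>B\<close>, joined to all of \<open>X\<close>, links the block
  to the path so far. One filler is spent per vertex of \<open>T\<close>, hence the cardinality
  condition.\<close>

lemma zigzag_blocks:
  assumes "finite T" "zigzag E p" "p \<noteq> []" "last p \<in> X" "E \<subseteq> X \<times> Y" "X \<times> B \<subseteq> E" "finite B"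
    and "card (set p \<inter> B) + card T \<le> card B" "T \<inter> set p = {}" "T \<subseteq> Y" "T \<inter> B = {}"
    and "\<And>v. v \<in> T \<Longrightarrow> P v \<subseteq> E\<inverse> `` {v}" "\<And>v. v \<in> T \<Longrightarrow> 2 \<le> card (P v)" "\<And>v. v \<in> T \<Longrightarrow> P v \<inter> set p = {}"
    and "\<And>v w. v \<in> T \<Longrightarrow> w \<in> T \<Longrightarrow> v \<noteq> w \<Longrightarrow> P v \<inter> P w = {}"
  shows "\<exists>q. zigzag E (p @ q) \<and> T \<subseteq> set q \<and> set q \<inter> Y \<subseteq> T \<union> B"
  using assms
proof (induction T arbitrary: p rule: finite_induct)
  case empty
  then show ?case by (intro exI[of _ "[]"]) auto
next
  case (insert t T)
  have "card (set p \<inter> B) < card B" using insert by simp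
  then have "\<not> B \<subseteq> set p" by (metis Int_absorb1 nat_neq_iff)
  then obtain b where b: "b \<in> B" "b \<notin> set p" by auto
  have "\<exists>a\<in>P t. \<exists>c\<in>P t. a \<noteq> c"
  proof -
    have "2 \<le> card (P t)" using insert by simp
    then obtain Z where "Z \<subseteq> P t" "card Z = 2" by (metis obtain_subset_with_card_n)
    then show ?thesis by (auto simp: card_2_iff)
  qed
  then obtain a c where ac: "a \<in> P t" "c \<in> P t" "a \<noteq> c" by blast
  have ac': "(a, t) \<in> E" "(c, t) \<in> E" "a \<in> X" "c \<in> X" "a \<notin> set p" "c \<notin> set p"
    using ac insert.prems(11)[of t] insert.prems(13)[of t] insert.prems(4) by auto
  have nY: "a \<notin> Y" "c \<notin> Y" using ac' disj by auto
  have tb: "t \<in> Y" "t \<noteq> b" "b \<in> Y" "t \<notin> B" using insert.prems b ac' by auto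
  have ne: "a \<noteq> b" "a \<noteq> t" "c \<noteq> b" "c \<noteq> t" using nY tb by auto
  let ?p = "(p @ [b, a]) @ [t, c]"
  have z1: "zigzag E (p @ [b, a])"
    by (rule zigzag.snoc) (use insert.prems b ac' ne in auto)
  have z2: "zigzag E ?p"
    by (rule zigzag.snoc[OF z1]) (use insert.prems b ac' ne ac tb in auto)
  have "set ?p \<inter> B = insert b (set p \<inter> B)" using b nY tb ac' insert.prems(4,5) by auto
  then have "card (set ?p \<inter> B) = Suc (card (set p \<inter> B))" using b insert.prems(6) by simp
  then have c: "card (set ?p \<inter> B) + card T \<le> card B" using insert by simp
  have "\<exists>q. zigzag E (?p @ q) \<and> T \<subseteq> set q \<and> set q \<inter> Y \<subseteq> T \<union> B"
  proof (rule insert.IH[OF z2 _ _ _ _ _ c])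
    show "T \<inter> set ?p = {}" using insert.prems insert.hyps b ac' nY by auto
    show "P v \<inter> set ?p = {}" if "v \<in> T" for v
    proof -
      have "P v \<inter> set p = {}" "P v \<inter> P t = {}" "P v \<subseteq> X" 
        using that insert.prems(13)[of v] insert.prems(14)[of v t] insert.hyps(2)
          insert.prems(11)[of v] insert.prems(4) by auto
      moreover have "b \<notin> X" "t \<notin> X" using tb disj by auto
      ultimately show ?thesis using ac by auto
    qed
  qed (use insert.prems ac' in auto)
  then obtain q where "zigzag E (?p @ q)" "T \<subseteq> set q" "set q \<inter> Y \<subseteq> T \<union> B" by auto
  then show ?case using tb nY b by (intro exI[of _ "[b, a, t, c] @ q"]) auto
qed

text \<open>Put \<open>s = card S\<close>. As \<open>Y - S\<close> is joined to all of
  \<open>X\<close>, a vertex \<open>x\<close> of \<open>X\<close> has degree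
  \<open>n - s + card (M x)\<close>, and closedness becomes
  \<open>card (M x) + card (N v) \<le> s\<close> for nonadjacent pairs (\<open>key\<close>). Degrees
  in \<open>S\<close> are thus \<open>s - 1\<close> or \<open>s\<close>, and a vertex of
  \<open>X\<close> missing some member of \<open>S\<close> has at most one neighbour in
  \<open>S\<close>. In all but the two listed configurations a zigzag through \<open>S\<close>
  exists, which \<open>spanned_if_zigzag\<close> completes.\<close>

lemma one_sided:
  assumes E: "E \<subseteq> X \<times> Y" and cl: "degree_closed E" and S: "S \<subseteq> Y" "S \<noteq> {}"
    and full: "X \<times> (Y - S) \<subseteq> E"
    and deg: "\<And>v. v \<in> S \<Longrightarrow> card S \<le> Suc (card (E\<inverse> `` {v}))" "\<And>v. v \<in> S \<Longrightarrow> card (E\<inverse> `` {v}) < n"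
    and n: "2 * card S \<le> n" and ns: "\<not> spanned (X \<union> Y) E"
  shows "(\<exists>W. Suc (card W) = card S \<and> (\<forall>v\<in>S. E\<inverse> `` {v} = W)) \<or>
    (\<exists>s1 s2 p1 p2. S = {s1, s2} \<and> s1 \<noteq> s2 \<and> p1 \<noteq> p2 \<and> E\<inverse> `` {s1} = {p1} \<and> E\<inverse> `` {s2} = {p2})"
proof -
  define N where "N v = E\<inverse> `` {v}" for v
  define M where "M x = E `` {x} \<inter> S" for x
  define s where "s = card S"
  have finS: "finite S" using S(1) fin(2) by (rule finite_subset)
  have NX: "N v \<subseteq> X" and finN: "finite (N v)" for v using E finite_nb(2)[OF E] by (auto simp: N_def)
  have finM: "finite (M x)" for x using finS by (simp add: M_def)
  have s: "s \<ge> 1" "2 * s \<le> n" using finS S(2) n by (auto simp: s_def Suc_le_eq card_gt_0_iff)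
  have SX: "v \<notin> X" if "v \<in> S" for v using that S(1) disj by auto
  have adj: "(x, v) \<in> E \<longleftrightarrow> x \<in> N v" for x v by (simp add: N_def)
  have adjM: "(x, v) \<in> E \<longleftrightarrow> v \<in> M x" if "v \<in> S" for x v using that by (simp add: M_def)
  have dX: "card (E `` {x}) + s = n + card (M x)" if "x \<in> X" for x
  proof -
    have "E `` {x} = (Y - S) \<union> M x" using full E that by (auto simp: M_def)
    moreover have "(Y - S) \<inter> M x = {}" by (auto simp: M_def)
    ultimately have "card (E `` {x}) = card (Y - S) + card (M x)"
      using finM fin by (simp add: card_Un_disjoint)
    moreover have "card (Y - S) + s = n"
      using S(1) finS by (metis add.commute card_Diff_subset card_mono card_parts(2) fin(2) le_add_diff_inverse s_def)
    ultimately show ?thesis by simp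
  qed
  have key: "card (M x) + card (N v) \<le> s" if "x \<in> X" "v \<in> S" "x \<notin> N v" for x v
  proof -
    have "card (E `` {x}) + card (N v) \<le> n"
      using cl that S(1) unfolding degree_closed_def N_def by auto
    then show ?thesis using dX[OF that(1)] by linarith
  qed
  have lo: "s \<le> Suc (card (N v))" if "v \<in> S" for v using deg(1)[OF that] by (simp add: N_def s_def)
  have hi: "card (N v) \<le> s" if "v \<in> S" for v
  proof -
    have "N v \<noteq> X" using deg(2)[OF that] card_parts by (auto simp: N_def)
    then obtain x where "x \<in> X" "x \<notin> N v" using NX by blast
    then show ?thesis using key[of x v] that by simp
  qed
  have span: "False" if "zigzag E p" "S \<subseteq> set p" for p
    using spanned_if_zigzag[OF that(1) E] full that(2) ns by auto
  consider (A) v where "v \<in> S" "card (N v) = s" | (B) "\<And>v. v \<in> S \<Longrightarrow> Suc (card (N v)) = s"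
    using lo hi by (metis le_SucE le_antisym)
  then show ?thesis
  proof cases
    case A
    define W where "W = N v"
    have W: "W \<subseteq> X" "card W = s" "finite W" using NX A finN by (auto simp: W_def)
    have "M x = {}" if "x \<in> X" "x \<notin> W" for x using key[of x v] A that finM by (simp add: W_def)
    then have NW: "N v' \<subseteq> W" if "v' \<in> S" for v' using that adj adjM NX by blast
    \<comment> \<open>A vertex \<open>w\<close> of \<open>W\<close> missed by \<open>v'\<close> is
      seen by \<open>v\<close> alone. So the rest of \<open>S\<close> is complete to
      \<open>W - {w}\<close>, of matching size, and \<open>v, w\<close> can be appended.\<close>
    have False if v': "v' \<in> S" "N v' \<noteq> W" for v'
    proof -
      obtain w where w: "w \<in> W" "w \<notin> N v'" using NW[OF v'(1)] v'(2) by blast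
      have wX: "w \<in> X" using w W by auto
      have "card (M w) \<le> 1" using key[of w v'] lo[of v'] that w wX by simp
      moreover have "v \<in> M w" using w A adj adjM unfolding W_def by blast
      ultimately have Mw: "M w = {v}" using finM[of w]
        by (metis card_1_singletonE card_gt_0_iff empty_iff less_one nat_less_le singletonD)
      have NWw: "N v'' = W - {w}" if "v'' \<in> S - {v}" for v''
      proof (rule card_subset_eq)
        have "w \<notin> N v''" using Mw that adj adjM by blast
        then show "N v'' \<subseteq> W - {w}" using NW that by blast
        then have "card (N v'') \<le> card (W - {w})" using W by (intro card_mono) auto
        moreover have "Suc (card (W - {w})) = s" using w W s by simp
        ultimately show "card (N v'') = card (W - {w})" using lo[of v''] that by simp
      qed (use W in auto)
      have "\<exists>q. zigzag E ([] @ q) \<and> set q = (W - {w}) \<union> (S - {v}) \<and> (q \<noteq> [] \<longrightarrow> last q \<in> W - {w})"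
      proof (rule zigzag_interleave)
        show "card (S - {v}) = card (W - {w})" using A w W finS by (simp add: s_def)
        show "(W - {w}) \<times> (S - {v}) \<subseteq> E" using NWw adj by blast
      qed (use finS W SX in \<open>auto intro: zigzag.Nil\<close>)
      then obtain q where q: "zigzag E q" "set q = (W - {w}) \<union> (S - {v})" "q \<noteq> [] \<longrightarrow> last q \<in> W - {w}"
        by auto
      have "zigzag E (q @ [v, w])"
        using q w A adj SX W by (intro zigzag.snoc) (auto simp: W_def)
      then show False using span[of "q @ [v, w]"] q by auto
    qed
    then have all: "N v' = W" if "v' \<in> S" for v' using that by blast
    have "\<exists>q. zigzag E ([] @ q) \<and> set q = W \<union> S \<and> (q \<noteq> [] \<longrightarrow> last q \<in> W)"
    proof (rule zigzag_interleave)
      show "W \<times> S \<subseteq> E" using all adj by blast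
    qed (use finS W SX in \<open>auto simp: s_def intro: zigzag.Nil\<close>)
    then obtain q where "zigzag E q" "set q = W \<union> S" by auto
    then show ?thesis using span[of q] by auto
  next
    case B
    define C where "C = {x \<in> X. \<forall>v\<in>S. x \<in> N v}"
    have CN: "C \<subseteq> N v" if "v \<in> S" for v using that by (auto simp: C_def)
    have finC: "finite C" by (simp add: C_def)
    show ?thesis
    proof (cases "\<forall>v\<in>S. N v = C")
      case True
      moreover have "Suc (card C) = card S" using S(2) True B by (auto simp: s_def)
      ultimately show ?thesis unfolding N_def by blast
    next
      case False
      then obtain v0 where v0: "v0 \<in> S" "C \<subset> N v0" using CN by blast
      have "card C < card (N v0)" using v0 finN by (intro psubset_card_mono) auto
      then have C: "card C + 2 \<le> s" using B[OF v0(1)] by simp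
      \<comment> \<open>A neighbour outside the common part \<open>C\<close> misses some vertex of
        \<open>S\<close>, so by \<open>key\<close> it is private to a single vertex of
        \<open>S\<close>.\<close>
      define P where "P v = N v - C" for v
      have cP: "Suc (card (P v)) + card C = s" if "v \<in> S" for v
        using B[OF that] CN[OF that] finC finN card_mono[OF finN CN[OF that]]
        by (simp add: P_def card_Diff_subset)
      have PM: "M x = {v}" if x: "v \<in> S" "x \<in> P v" for x v
      proof -
        obtain v' where "v' \<in> S" "x \<notin> N v'" "x \<in> X" using x NX by (auto simp: P_def C_def)
        then have "card (M x) \<le> 1" using key[of x v'] B[of v'] by simp
        moreover have "v \<in> M x" using that adj adjM by (auto simp: P_def)
        ultimately show ?thesis using finM[of x]
          by (metis card_1_singletonE card_gt_0_iff empty_iff less_one nat_less_le singletonD)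
      qed
      have Pdisj: "P v \<inter> P w = {}" if "v \<in> S" "w \<in> S" "v \<noteq> w" for v w
        using that PM by (metis disjoint_iff singleton_inject)
      have PX: "P v \<subseteq> X" for v using NX by (auto simp: P_def)
      have PE: "(x, v) \<in> E" if "x \<in> P v" for x v using that adj by (auto simp: P_def)
      have CE: "(x, v) \<in> E" if "x \<in> C" "v \<in> S" for x v using that adj CN by blast
      have Pne: "\<exists>x. x \<in> P v" if "v \<in> S" for v
      proof -
        have "card (P v) \<noteq> 0" using cP[OF that] C by simp
        then show ?thesis by (metis card.empty ex_in_conv)
      qed
      have YS: "card (Y - S) \<ge> s"
        using s S(1) finS by (simp add: card_Diff_subset s_def card_parts)
      then obtain y where y: "y \<in> Y" "y \<notin> S" using s by (metis Diff_iff card.empty ex_in_conv le_zero_eq not_one_le_zero)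
      have yX: "y \<notin> X" using y disj by auto
      have yE: "(x, y) \<in> E" if "x \<in> X" for x using full y that by auto
      \<comment> \<open>Here \<open>card (P v) = s - 1 - card C\<close>: the case split separates
        exactly one private neighbour per vertex from at least two, as \<open>zigzag_blocks\<close>
        demands.\<close>
      show ?thesis
      proof (cases "card C + 2 = s")
        case True
        show ?thesis
        proof (cases "s = 2")
          case True
          then obtain s1 s2 where s12: "S = {s1, s2}" "s1 \<noteq> s2" unfolding s_def card_2_iff by auto
          have "card (N s1) = 1" "card (N s2) = 1" using B[of s1] B[of s2] s12 True by auto
          then obtain p1 p2 where p12: "N s1 = {p1}" "N s2 = {p2}" by (auto simp: card_1_singleton_iff)
          have "C = {}" using C True finC by simp
          then have "p1 \<in> P s1" "p2 \<in> P s2" using p12 by (simp_all add: P_def)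
          then have "p1 \<noteq> p2" using Pdisj[of s1 s2] s12 by blast
          then show ?thesis using s12 p12 unfolding N_def by blast
        next
          case False
          then have s3: "3 \<le> s" using C by simp
          then obtain Z where Z: "Z \<subseteq> S" "card Z = 3" unfolding s_def by (metis obtain_subset_with_card_n)
          then obtain a b c where abc: "a \<in> S" "b \<in> S" "c \<in> S" "a \<noteq> b" "a \<noteq> c" "b \<noteq> c"
            by (auto simp: card_3_iff)
          obtain pa pb pc where p: "pa \<in> P a" "pb \<in> P b" "pc \<in> P c" using Pne abc by metis
          have ne: "pa \<noteq> pb" "pa \<noteq> pc" "pb \<noteq> pc" using p abc Pdisj by blast+
          have pC: "pa \<notin> C" "pb \<notin> C" "pc \<notin> C" using p by (auto simp: P_def)
          have pX: "pa \<in> X" "pb \<in> X" "pc \<in> X" using p PX by auto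
          have "card C \<noteq> 0" using s3 True by simp
          then obtain c1 where c1: "c1 \<in> C" by (metis card.empty ex_in_conv)
          have CX: "C \<subseteq> X" by (auto simp: C_def)
          \<comment> \<open>The path is \<open>a, pa, y, pb, b, c1\<close>, then
            \<open>C - {c1}\<close> interleaved with \<open>S - {a, b, c}\<close>, then
            \<open>c, pc\<close>. The filler \<open>y\<close> joins two private neighbours, and the
            sizes agree because \<open>card C - 1 = s - 3\<close>.\<close>
          have z1: "zigzag E ([] @ [a, pa])"
            by (rule zigzag.snoc) (use p PE abc SX pX in \<open>auto intro: zigzag.Nil\<close>)
          have z2: "zigzag E (([] @ [a, pa]) @ [y, pb])"
            by (rule zigzag.snoc[OF z1]) (use ne yE pX y abc SX yX in auto)
          have z3: "zigzag E ((([] @ [a, pa]) @ [y, pb]) @ [b, c1])"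
            by (rule zigzag.snoc[OF z2]) (use ne yE pX y abc SX yX c1 pC CX CE PE p in auto)
          let ?p = "(([] @ [a, pa]) @ [y, pb]) @ [b, c1]"
          have "\<exists>q. zigzag E (?p @ q) \<and> set q = (C - {c1}) \<union> (S - {a, b, c}) \<and> (q \<noteq> [] \<longrightarrow> last q \<in> C - {c1})"
          proof (rule zigzag_interleave[OF z3])
            have "card (S - {a, b, c}) = s - 3" using abc finS by (simp add: s_def card_Diff_subset)
            moreover have "card (C - {c1}) = card C - 1" using c1 by simp
            ultimately show "card (S - {a, b, c}) = card (C - {c1})" using True s3 by simp
            show "?p = [] \<or> {last ?p} \<times> (S - {a, b, c}) \<subseteq> E" using CE c1 by auto
            show "((C - {c1}) \<union> (S - {a, b, c})) \<inter> set ?p = {}"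
              using pC SX pX CX y yX abc c1 by auto
          qed (use finS finC CE CX SX in auto)
          then obtain q where q: "zigzag E (?p @ q)" "set q = (C - {c1}) \<union> (S - {a, b, c})" "q \<noteq> [] \<longrightarrow> last q \<in> C - {c1}"
            by auto
          have "last (?p @ q) \<in> C" using q c1 by auto
          have "zigzag E ((?p @ q) @ [c, pc])"
          proof (rule zigzag.snoc[OF q(1)])
            show "?p @ q = [] \<or> (last (?p @ q), c) \<in> E" using \<open>last (?p @ q) \<in> C\<close> CE abc by blast
            show "(pc, c) \<in> E" using p(3) by (rule PE)
            have set: "set (?p @ q) = {a, pa, y, pb, b} \<union> C \<union> (S - {a, b, c})"
              using q(2) c1 by auto
            show "pc \<notin> set (?p @ q)"
              unfolding set using pX(3) pC(3) ne abc(1,2) yX SX by blast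
            show "c \<notin> set (?p @ q)"
              unfolding set using abc y CX SX pX by blast
          qed
          then have False by (rule span) (use q in auto)
          then show ?thesis ..
        qed
      next
        case False
        then have P2: "2 \<le> card (P v)" if "v \<in> S" for v using cP[OF that] C by simp
        obtain a where a: "a \<in> P v0" using Pne v0 by blast
        have aX: "a \<in> X" using a PX by blast
        have z1: "zigzag E ([] @ [v0, a])"
          by (rule zigzag.snoc) (use a PE v0 SX aX in \<open>auto intro: zigzag.Nil\<close>)
        have "\<exists>q. zigzag E (([] @ [v0, a]) @ q) \<and> S - {v0} \<subseteq> set q \<and> set q \<inter> Y \<subseteq> (S - {v0}) \<union> (Y - S)"
        proof (rule zigzag_blocks[OF _ z1])
          have "set ([] @ [v0, a]) \<inter> (Y - S) = {}" using v0 aX disj by auto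
          then show "card (set ([] @ [v0, a]) \<inter> (Y - S)) + card (S - {v0}) \<le> card (Y - S)"
            using YS v0 s finS by (simp add: s_def)
          show "P v \<inter> set ([] @ [v0, a]) = {}" if "v \<in> S - {v0}" for v
            using that Pdisj[of v v0] v0 a SX PX by auto
        qed (use aX S E full PE P2 Pdisj finS SX in auto)
        then obtain q where q: "zigzag E (([] @ [v0, a]) @ q)" "S - {v0} \<subseteq> set q" by blast
        have False by (rule span[OF q(1)]) (use q in auto)
        then show ?thesis ..
      qed
    qed
  qed
qed

lemma closed_swap: "E \<subseteq> X \<times> Y \<Longrightarrow> degree_closed E \<Longrightarrow> balanced_parts.degree_closed Y X n (E\<inverse>)"
  by (auto simp: degree_closed_def balanced_parts.degree_closed_def[OF swap] add.commute)

section \<open>Counting missing edges; the gap in the degree sequence\<close>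

lemma card_missing_ge:
  assumes "E \<subseteq> X \<times> Y" "T \<subseteq> X" "\<And>x. x \<in> T \<Longrightarrow> card (E `` {x}) + m \<le> n"
  shows "m * card T \<le> card (T \<times> Y - E)"
proof -
  have "T \<times> Y - E = Sigma T (\<lambda>x. Y - E `` {x})" by auto
  moreover have "finite T" using assms(2) fin(1) by (rule finite_subset)
  ultimately have "card (T \<times> Y - E) = (\<Sum>x\<in>T. card (Y - E `` {x}))"
    by (simp add: card_SigmaI)
  also have "\<dots> \<ge> (\<Sum>x\<in>T. m)"
  proof (rule sum_mono)
    fix x assume x: "x \<in> T"
    have "E `` {x} \<subseteq> Y" using assms(1) by auto
    then have "card (Y - E `` {x}) = n - card (E `` {x})"
      using finite_nb(1)[OF assms(1)] by (simp add: card_Diff_subset card_parts)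
    then show "m \<le> card (Y - E `` {x})" using assms(3)[OF x] by simp
  qed
  finally show ?thesis by (simp add: mult.commute)
qed

lemma card_missing_ge':
  assumes "E \<subseteq> X \<times> Y" "S \<subseteq> Y" "\<And>y. y \<in> S \<Longrightarrow> card (E\<inverse> `` {y}) + m \<le> n"
  shows "m * card S \<le> card (X \<times> S - E)"
proof -
  have "m * card S \<le> card (S \<times> X - E\<inverse>)"
    by (rule balanced_parts.card_missing_ge[OF swap]) (use assms in auto)
  also have "S \<times> X - E\<inverse> = (X \<times> S - E)\<inverse>" by auto
  finally show ?thesis by (simp only: card_inverse)
qed

lemma card_missing_swap: "card (Y \<times> X - E\<inverse>) = card (X \<times> Y - E)"
proof -
  have "Y \<times> X - E\<inverse> = (X \<times> Y - E)\<inverse>" by auto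
  then show ?thesis by (simp only: card_inverse)
qed

text \<open>Inclusion-exclusion: only pairs in \<open>T \<times> S\<close> can be counted from both
  sides.\<close>

lemma card_missing_two_sided:
  assumes E: "E \<subseteq> X \<times> Y" and ST: "S \<subseteq> Y" "T \<subseteq> X"
    and "\<And>y. y \<in> S \<Longrightarrow> card (E\<inverse> `` {y}) + m \<le> n" "\<And>x. x \<in> T \<Longrightarrow> card (E `` {x}) + m \<le> n"
  shows "m * (card S + card T) \<le> card (X \<times> Y - E) + card S * card T"
proof -
  let ?A = "X \<times> S - E" and ?B = "T \<times> Y - E"
  have f: "finite S" "finite T" using ST fin finite_subset by blast+
  have fAB: "finite ?A" "finite ?B" using f by auto
  have "m * card S \<le> card ?A" "m * card T \<le> card ?B"
    using card_missing_ge'[OF E ST(1) assms(4)] card_missing_ge[OF E ST(2) assms(5)] by blast+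
  moreover have "card ?A + card ?B = card (?A \<union> ?B) + card (?A \<inter> ?B)"
    by (rule card_Un_Int[OF fAB])
  moreover have "card (?A \<union> ?B) \<le> card (X \<times> Y - E)"
    by (rule card_mono) (use ST in auto)
  moreover have "card (?A \<inter> ?B) \<le> card (T \<times> S)"
    by (rule card_mono) (use f in auto)
  ultimately show ?thesis by (simp add: card_cartesian_product algebra_simps)
qed

text \<open>If \<open>v\<close> has degree \<open>d\<close>, closedness bounds the degree of each of
  its \<open>n - d\<close> nonneighbours by \<open>n - d\<close>, so each of them misses at least
  \<open>d\<close> vertices.\<close>

lemma degree_product:
  assumes E: "E \<subseteq> X \<times> Y" and cl: "degree_closed E" and v: "v \<in> Y"
  shows "card (E\<inverse> `` {v}) * (n - card (E\<inverse> `` {v})) \<le> card (X \<times> Y - E)"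
proof -
  let ?N = "E\<inverse> `` {v}"
  have "?N \<subseteq> X" using E by auto
  then have "card (X - ?N) = n - card ?N" using finite_nb(2)[OF E] by (simp add: card_Diff_subset card_parts)
  moreover have "card ?N * card (X - ?N) \<le> card ((X - ?N) \<times> Y - E)"
    by (rule card_missing_ge) (use E cl v in \<open>auto simp: degree_closed_def\<close>)
  moreover have "\<dots> \<le> card (X \<times> Y - E)" by (rule card_mono) auto
  ultimately show ?thesis by simp
qed

text \<open>The tie left by \<open>middle_degree_arith\<close>: \<open>d * (n - d) = 4\<close> uses
  up the budget, so all missing edges lie at the two nonneighbours of \<open>v\<close>, each of
  degree 2. With the parts swapped, \<open>one_sided\<close> would make these degrees 1.\<close>

lemma exceptional_degree:
  assumes E: "E \<subseteq> X \<times> Y" and cl: "degree_closed E" and ns: "\<not> spanned (X \<union> Y) E" and v: "v \<in> Y"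
    and n: "n = 4" "card (E\<inverse> `` {v}) = 2" and miss: "card (X \<times> Y - E) \<le> 4"
  shows False
proof -
  let ?N = "E\<inverse> `` {v}"
  define U where "U = X - ?N"
  have "?N \<subseteq> X" using E by auto
  then have cU: "card U = 2" unfolding U_def using finite_nb(2)[OF E] n by (simp add: card_Diff_subset card_parts)
  have UX: "U \<subseteq> X" and fU: "finite U" by (auto simp: U_def)
  have le2: "card (E `` {x}) + 2 \<le> n" if "x \<in> U" for x
  proof -
    have "card (E `` {x}) + card ?N \<le> n" using cl that v unfolding U_def degree_closed_def by blast
    then show ?thesis using n(2) by simp
  qed
  have "2 * card U \<le> card (U \<times> Y - E)" by (rule card_missing_ge[OF E UX le2])
  then have "U \<times> Y - E = X \<times> Y - E" using miss cU UX by (intro card_seteq) auto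
  then have full: "Y \<times> (X - U) \<subseteq> E\<inverse>" by auto
  have ge2: "card (E `` {x}) = 2" if x: "x \<in> U" for x
  proof (rule antisym)
    show "card (E `` {x}) \<le> 2" using le2[OF x] n by simp
    have "2 * card (U - {x}) \<le> card ((U - {x}) \<times> Y - E)"
      by (rule card_missing_ge) (use E UX le2 in auto)
    moreover have "card (({x} \<times> Y - E) \<union> ((U - {x}) \<times> Y - E)) \<le> card (X \<times> Y - E)"
      by (rule card_mono) (use UX x in auto)
    moreover have "card (({x} \<times> Y - E) \<union> ((U - {x}) \<times> Y - E))
        = card ({x} \<times> Y - E) + card ((U - {x}) \<times> Y - E)"
      by (rule card_Un_disjoint) (use fU in auto)
    moreover have "card (U - {x}) = 1" using cU x fU by simp
    ultimately have "card ({x} \<times> Y - E) \<le> 2" using miss by simp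
    also have "{x} \<times> Y - E = {x} \<times> (Y - E `` {x})" by auto
    finally have "card (Y - E `` {x}) \<le> 2" by (simp add: card_cartesian_product)
    moreover have "E `` {x} \<subseteq> Y" using E by auto
    then have "card (Y - E `` {x}) = 4 - card (E `` {x})"
      using n finite_nb(1)[OF E] by (simp add: card_Diff_subset card_parts)
    ultimately show "2 \<le> card (E `` {x})" by simp
  qed
  have "U \<noteq> {}" using cU by auto
  have "(\<exists>W. Suc (card W) = card U \<and> (\<forall>v\<in>U. (E\<inverse>)\<inverse> `` {v} = W)) \<or>
    (\<exists>s1 s2 p1 p2. U = {s1, s2} \<and> s1 \<noteq> s2 \<and> p1 \<noteq> p2 \<and> (E\<inverse>)\<inverse> `` {s1} = {p1} \<and> (E\<inverse>)\<inverse> `` {s2} = {p2})"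
    by (rule balanced_parts.one_sided[OF swap])
      (use E closed_swap[OF E cl] UX \<open>U \<noteq> {}\<close> full ge2 cU n ns in \<open>auto simp: Un_commute\<close>)
  then show False
  proof
    assume "\<exists>W. Suc (card W) = card U \<and> (\<forall>v\<in>U. (E\<inverse>)\<inverse> `` {v} = W)"
    then obtain W where "Suc (card W) = card U" "\<forall>v\<in>U. E `` {v} = W" by auto
    then show False using ge2 cU \<open>U \<noteq> {}\<close> by auto
  next
    assume "\<exists>s1 s2 p1 p2. U = {s1, s2} \<and> s1 \<noteq> s2 \<and> p1 \<noteq> p2 \<and> (E\<inverse>)\<inverse> `` {s1} = {p1} \<and> (E\<inverse>)\<inverse> `` {s2} = {p2}"
    then obtain s1 p1 where "s1 \<in> U" "E `` {s1} = {p1}" by auto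
    then show False using ge2[of s1] by simp
  qed
qed

lemma degree_dichotomy:
  assumes E: "E \<subseteq> X \<times> Y" and cl: "degree_closed E" and ns: "\<not> spanned (X \<union> Y) E" and v: "v \<in> Y"
    and n: "(k + 2)\<^sup>2 \<le> n" and miss: "card (X \<times> Y - E) \<le> n * (k + 1)"
    and strict: "k \<ge> 1 \<Longrightarrow> card (X \<times> Y - E) < n * (k + 1)"
  shows "card (E\<inverse> `` {v}) \<le> k + 1 \<or> n \<le> card (E\<inverse> `` {v}) + k + 1"
proof (rule ccontr)
  let ?d = "card (E\<inverse> `` {v})"
  assume "\<not> ?thesis"
  then have d: "k + 2 \<le> ?d" "?d + k + 2 \<le> n" by auto
  note ar = middle_degree_arith[OF n d]
  note prod = degree_product[OF E cl v]
  show False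
  proof (cases "k = 0")
    case True
    then have "n = 4 \<and> ?d = 2" using ar(2) prod miss by simp
    then show False using exceptional_degree[OF E cl ns v] miss True by simp
  next
    case False
    then show False using strict ar(1) prod by simp
  qed
qed

section \<open>Vertices of small degree\<close>

lemma card_small_le:
  assumes E: "E \<subseteq> X \<times> Y" and S: "S \<subseteq> Y" "\<And>y. y \<in> S \<Longrightarrow> card (E\<inverse> `` {y}) \<le> k + 1"
    and n: "(k + 2)\<^sup>2 \<le> n" and miss: "card (X \<times> Y - E) \<le> n * (k + 1)"
  shows "card S \<le> k + 1"
proof (rule ccontr)
  assume "\<not> ?thesis"
  then have "k + 2 \<le> card S" by simp
  then obtain S' where S': "S' \<subseteq> S" "card S' = k + 2" by (metis obtain_subset_with_card_n)
  have kn: "k + 1 \<le> n" using n by (simp add: power2_eq_square)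
  \<comment> \<open>For \<open>k + 2\<close> small vertices the count exceeds the budget by at least
    \<open>n - (k + 1) * (k + 2)\<close>, which is positive.\<close>
  have "(n - (k + 1)) * card S' \<le> card (X \<times> S' - E)"
    by (rule card_missing_ge'[OF E]) (use S' S kn in fastforce)+
  also have "\<dots> \<le> card (X \<times> Y - E)" by (rule card_mono) (use S' S in auto)
  also note miss
  finally have "(n - (k + 1)) * (k + 2) \<le> n * (k + 1)" using S' by simp
  moreover obtain m where "n = (k + 1) + m" using kn le_Suc_ex by blast
  ultimately show False using n by (simp add: power2_eq_square algebra_simps)
qed

text \<open>The degree of \<open>u\<close> is too small to cover \<open>Y - S\<close>, so some
  \<open>y\<close> there is not adjacent to \<open>u\<close>. That \<open>y\<close> sees all
  \<open>n - card T\<close> vertices of \<open>X - T\<close>, and closedness at \<open>u\<close>,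
  \<open>y\<close> gives the bound.\<close>

lemma small_degree_le:
  assumes E: "E \<subseteq> X \<times> Y" and cl: "degree_closed E" and S: "S \<subseteq> Y" "card S \<le> k + 1"
    and T: "T \<subseteq> X" "\<And>x. x \<in> T \<Longrightarrow> card (E `` {x}) \<le> k + 1"
    and full: "(X - T) \<times> (Y - S) \<subseteq> E" and n: "2 * k + 2 < n" and u: "u \<in> T"
  shows "card (E `` {u}) \<le> card T"
proof -
  have finS: "finite S" "finite T" using S(1) T(1) fin finite_subset by blast+
  have "card (Y - S) = n - card S" using S finS by (simp add: card_Diff_subset card_parts)
  then have "card (E `` {u}) < card (Y - S)" using T(2)[OF u] S(2) n by simp
  then have "\<not> Y - S \<subseteq> E `` {u}" using finite_nb(1)[OF E] by (meson card_mono leD)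
  then obtain y where y: "y \<in> Y" "y \<notin> S" "(u, y) \<notin> E" by auto
  have "card (X - T) \<le> card (E\<inverse> `` {y})" by (rule card_mono) (use finite_nb(2)[OF E] full y in auto)
  moreover have "card (X - T) + card T = n"
    using T(1) finS card_mono[OF fin(1) T(1)] by (simp add: card_Diff_subset card_parts)
  moreover have "card (E `` {u}) + card (E\<inverse> `` {y}) \<le> n"
    using cl y u T(1) unfolding degree_closed_def by blast
  ultimately show ?thesis by linarith
qed

text \<open>The path starts with \<open>v, x0\<close>, ends with \<open>y0, u\<close> and
  interleaves the remaining, completely joined vertices in between.\<close>

lemma two_pendants:
  assumes E: "E \<subseteq> X \<times> Y" and uv: "u \<in> X" "v \<in> Y" and full: "(X - {u}) \<times> (Y - {v}) \<subseteq> E"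
    and nb: "E `` {u} = {y0}" "E\<inverse> `` {v} = {x0}" and y0: "y0 \<noteq> v"
  shows "spanned (X \<union> Y) E"
proof -
  have x0: "x0 \<noteq> u" using nb y0 by auto
  have in_E: "(u, y0) \<in> E" "(x0, v) \<in> E" using nb by auto
  then have m: "y0 \<in> Y" "x0 \<in> X" using E by auto
  have d: "a \<noteq> b" if "a \<in> X" "b \<in> Y" for a b using that disj by auto
  have z1: "zigzag E ([] @ [v, x0])"
    by (rule zigzag.snoc) (use in_E d m uv in \<open>auto intro: zigzag.Nil\<close>)
  have "\<exists>q. zigzag E (([] @ [v, x0]) @ q) \<and> set q = (X - {u, x0}) \<union> (Y - {v, y0}) \<and> (q \<noteq> [] \<longrightarrow> last q \<in> X - {u, x0})"
  proof (rule zigzag_interleave[OF z1])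
    show "card (Y - {v, y0}) = card (X - {u, x0})"
      using uv m x0 y0 by (simp add: card_Diff_subset card_parts)
  qed (use full d m uv x0 in auto)
  then obtain q where q: "zigzag E (([] @ [v, x0]) @ q)" "set q = (X - {u, x0}) \<union> (Y - {v, y0})"
      "q \<noteq> [] \<longrightarrow> last q \<in> X - {u, x0}" by blast
  have "last (([] @ [v, x0]) @ q) \<in> X - {u}" using q(3) x0 m by auto
  then have "(last (([] @ [v, x0]) @ q), y0) \<in> E" using full m y0 by blast
  then have z2: "zigzag E ((([] @ [v, x0]) @ q) @ [y0, u])"
    using in_E q(2) d m uv x0 y0 by (intro zigzag.snoc[OF q(1)]) auto
  show ?thesis
    by (rule spanned_if_zigzag[OF z2 E]) (use q(2) in auto)
qed

text \<open>The surviving graph is the disjoint union of a single edge and a complete bipartite graph.\<close>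

lemma both_sides_small:
  assumes E: "E \<subseteq> X \<times> Y" and cl: "degree_closed E" and ns: "\<not> spanned (X \<union> Y) E"
    and deg: "\<And>x. x \<in> X \<Longrightarrow> k \<le> card (E `` {x})" "\<And>y. y \<in> Y \<Longrightarrow> k \<le> card (E\<inverse> `` {y})"
    and n: "(k + 2)\<^sup>2 \<le> n" and miss: "card (X \<times> Y - E) \<le> n * (k + 1)"
    and strict: "k \<ge> 1 \<Longrightarrow> card (X \<times> Y - E) < n * (k + 1)"
    and S: "S \<subseteq> Y" "S \<noteq> {}" "\<And>y. y \<in> S \<Longrightarrow> card (E\<inverse> `` {y}) \<le> k + 1"
    and T: "T \<subseteq> X" "T \<noteq> {}" "\<And>x. x \<in> T \<Longrightarrow> card (E `` {x}) \<le> k + 1"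
    and full: "(X - T) \<times> (Y - S) \<subseteq> E"
  shows "k = 1 \<and> (\<forall>x\<in>X. card (E `` {x}) < n) \<and> (\<forall>y\<in>Y. card (E\<inverse> `` {y}) < n)"
proof -
  have nk: "k * k + 4 * k + 4 \<le> n" using n by (simp add: power2_eq_square algebra_simps)
  have finS: "finite S" "finite T" using S(1) T(1) fin finite_subset by blast+
  have nk': "2 * k + 2 < n" using nk by linarith
  have cS: "card S \<le> k + 1" by (rule card_small_le[OF E S(1,3) n miss])
  have cT: "card T \<le> k + 1"
    by (rule balanced_parts.card_small_le[OF swap, of "E\<inverse>"])
      (use E T n miss card_missing_swap in auto)
  have dT: "card (E `` {u}) \<le> card T" if "u \<in> T" for u
    by (rule small_degree_le[OF E cl S(1) cS T(1,3) full nk' that])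
  have dS: "card (E\<inverse> `` {v}) \<le> card S" if "v \<in> S" for v
    by (rule balanced_parts.small_degree_le[OF swap _ closed_swap[OF E cl] T(1) cT S(1) _ _ _ that, simplified])
      (use E S full nk' in auto)
  obtain u v where uv: "u \<in> T" "v \<in> S" using S T by blast
  have kST: "k \<le> card S" "k \<le> card T" using deg uv dS dT S(1) T(1) by (meson order_trans subsetD)+
  \<comment> \<open>Taken with sizes \<open>(1, 1)\<close> for \<open>k = 0\<close>,
    \<open>(k, k)\<close> for \<open>k \<ge> 2\<close>, and \<open>(2, 1)\<close> or
    \<open>(1, 2)\<close> for \<open>k = 1\<close>; each time the budget is exceeded.\<close>
  have count: "(n - (k + 1)) * (i + j) \<le> card (X \<times> Y - E) + i * j" if ij: "i \<le> card S" "j \<le> card T" for i j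
  proof -
    obtain S' T' where ST': "S' \<subseteq> S" "card S' = i" "T' \<subseteq> T" "card T' = j"
      using ij by (metis obtain_subset_with_card_n)
    have "(n - (k + 1)) * (card S' + card T') \<le> card (X \<times> Y - E) + card S' * card T'"
    proof (rule card_missing_two_sided[OF E])
      show "card (E\<inverse> `` {y}) + (n - (k + 1)) \<le> n" if "y \<in> S'" for y
        using S(3)[of y] that ST' nk by auto
      show "card (E `` {x}) + (n - (k + 1)) \<le> n" if "x \<in> T'" for x
        using T(3)[of x] that ST' nk by auto
    qed (use ST' S T in auto)
    then show ?thesis using ST' by simp
  qed
  have pos: "1 \<le> card S" "1 \<le> card T" using S(2) T(2) finS by (simp_all add: Suc_le_eq card_gt_0_iff)
  have "k = 1"
  proof (rule ccontr)
    assume "k \<noteq> 1"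
    then consider "k = 0" | "k \<ge> 2" by linarith
    then show False
    proof cases
      case 1
      then show False using count[OF pos] miss nk by simp
    next
      case 2
      then obtain j where j: "k = 2 + j" using le_Suc_ex by blast
      have "k + 1 \<le> n" using nk by simp
      then obtain m where m: "n = (k + 1) + m" using le_Suc_ex by blast
      have "m * (k + k) < n * (k + 1) + k * k" using count[OF kST] strict 2 m by simp
      then have "m * (k + k) < (k + 1 + m) * (k + 1) + k * k" using m by simp
      then have "m * (1 + j) < 13 + 10 * j + 2 * (j * j)" 
        unfolding j by (simp add: algebra_simps)
      \<comment> \<open>\<open>13 + 7 * j + j * j\<close> is \<open>k * k + 3 * k + 3\<close>, the
        lower bound that \<open>nk\<close> gives for \<open>m = n - k - 1\<close>.\<close>
      moreover have "(13 + 7 * j + j * j) * (1 + j) \<le> m * (1 + j)"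
        using nk m unfolding j by (intro mult_right_mono) (simp_all add: algebra_simps)
      ultimately show False by (simp add: algebra_simps)
    qed
  qed
  have cards: "card S = 1 \<and> card T = 1"
  proof (rule ccontr)
    assume "\<not> ?thesis"
    then have "2 \<le> card S \<or> 2 \<le> card T" using pos by linarith
    then have "(n - (k + 1)) * 3 \<le> card (X \<times> Y - E) + 2"
      using count[of 2 1] count[of 1 2] pos by auto
    then show False using strict \<open>k = 1\<close> nk by simp
  qed
  then have ST: "S = {v}" "T = {u}" using uv by (auto simp: card_1_singleton_iff)
  have "card (E `` {u}) = 1" "card (E\<inverse> `` {v}) = 1"
    using dT[OF uv(1)] dS[OF uv(2)] cards deg \<open>k = 1\<close> uv S(1) T(1) by (metis le_antisym subsetD)+
  then obtain y0 x0 where nb: "E `` {u} = {y0}" "E\<inverse> `` {v} = {x0}" by (auto simp: card_1_singleton_iff)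
  have y0: "y0 = v"
    using two_pendants[OF E _ _ _ nb] ns ST S(1) T(1) full by auto
  then have x0: "x0 = u" using nb by auto
  have "card (E `` {x}) < n" if x: "x \<in> X" for x
  proof (cases "x = u")
    case True
    then show ?thesis using nb nk by simp
  next
    case False
    then have "v \<notin> E `` {x}" using nb x0 by auto
    then have "E `` {x} \<subset> Y" using E ST S(1) by blast
    then show ?thesis using card_parts by (metis fin(2) psubset_card_mono)
  qed
  moreover have "card (E\<inverse> `` {y}) < n" if y: "y \<in> Y" for y
  proof (cases "y = v")
    case True
    then show ?thesis using nb nk by simp
  next
    case False
    then have "u \<notin> E\<inverse> `` {y}" using nb y0 by auto
    then have "E\<inverse> `` {y} \<subset> X" using E ST T(1) by blast
    then show ?thesis using card_parts by (metis fin(1) psubset_card_mono)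
  qed
  ultimately show ?thesis using \<open>k = 1\<close> by blast
qed

text \<open>With minimum degree \<open>k\<close> and \<open>card S \<le> k + 1\<close>,
  \<open>one_sided\<close> applies. A common neighbourhood must have size \<open>k\<close>; two
  pendant vertices give both \<open>k \<le> 1\<close> and \<open>2 \<le> k + 1\<close>.\<close>

lemma one_side_small:
  assumes E: "E \<subseteq> X \<times> Y" and cl: "degree_closed E" and ns: "\<not> spanned (X \<union> Y) E"
    and deg: "\<And>y. y \<in> Y \<Longrightarrow> k \<le> card (E\<inverse> `` {y})"
    and n: "(k + 2)\<^sup>2 \<le> n" and miss: "card (X \<times> Y - E) \<le> n * (k + 1)"
    and S: "S \<subseteq> Y" "\<And>y. y \<in> S \<Longrightarrow> card (E\<inverse> `` {y}) \<le> k + 1"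
    and full: "X \<times> (Y - S) \<subseteq> E"
  shows "Q_shape k X Y E \<or> k = 1 \<and> R_shape X Y E"
proof -
  have nk: "k * k + 4 * k + 4 \<le> n" using n by (simp add: power2_eq_square algebra_simps)
  have cS: "card S \<le> k + 1" by (rule card_small_le[OF E S n miss])
  have "S \<noteq> {}" using spanned_if_zigzag[OF zigzag.Nil E] full ns by auto
  have "(\<exists>W. Suc (card W) = card S \<and> (\<forall>v\<in>S. E\<inverse> `` {v} = W)) \<or>
    (\<exists>s1 s2 p1 p2. S = {s1, s2} \<and> s1 \<noteq> s2 \<and> p1 \<noteq> p2 \<and> E\<inverse> `` {s1} = {p1} \<and> E\<inverse> `` {s2} = {p2})"
  proof (rule one_sided[OF E cl S(1) \<open>S \<noteq> {}\<close> full])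
    fix v assume "v \<in> S"
    then have "k \<le> card (E\<inverse> `` {v})" "card (E\<inverse> `` {v}) \<le> k + 1" using deg S by auto
    then show "card S \<le> Suc (card (E\<inverse> `` {v}))" "card (E\<inverse> `` {v}) < n" using cS nk by simp_all
  qed (use cS nk ns in auto)
  then show ?thesis
  proof (elim disjE exE conjE)
    fix W assume W: "Suc (card W) = card S" "\<forall>v\<in>S. E\<inverse> `` {v} = W"
    then have 1: "Suc (card W) = card S" "\<And>v. v \<in> S \<Longrightarrow> E\<inverse> `` {v} = W" by blast+
    obtain v where v: "v \<in> S" using \<open>S \<noteq> {}\<close> by blast
    have "k \<le> card W" using deg[of v] v S(1) 1(2)[OF v] by auto
    then have "card W = k" "card S = k + 1" using 1(1) cS by simp_all
    moreover have "W \<subseteq> X" using 1(2)[OF v] E by auto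
    moreover have "E \<subseteq> X \<times> (Y - S) \<union> W \<times> S"
    proof (rule subrelI)
      fix a b assume ab: "(a, b) \<in> E"
      then have "a \<in> X" "b \<in> Y" "b \<in> S \<Longrightarrow> a \<in> W" using E 1(2)[of b] by auto
      then show "(a, b) \<in> X \<times> (Y - S) \<union> W \<times> S" by auto
    qed
    ultimately show ?thesis using S(1) unfolding Q_shape_def by blast
  next
    fix s1 s2 p1 p2
    assume 2: "S = {s1, s2}" "s1 \<noteq> s2" "p1 \<noteq> p2" "E\<inverse> `` {s1} = {p1}" "E\<inverse> `` {s2} = {p2}"
    have "k \<le> 1" using deg[of s1] 2 S(1) by simp
    moreover have "1 \<le> k" using cS 2 by simp
    moreover have "p1 \<in> X" "p2 \<in> X" using 2 E by auto
    moreover have "E \<subseteq> X \<times> (Y - {s1, s2}) \<union> {(p1, s1), (p2, s2)}"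
    proof
      fix e assume e: "e \<in> E"
      obtain a b where ab: "e = (a, b)" by (cases e)
      then have "a \<in> X" "b \<in> Y" "b = s1 \<Longrightarrow> a = p1" "b = s2 \<Longrightarrow> a = p2" using e E 2 by auto
      then show "e \<in> X \<times> (Y - {s1, s2}) \<union> {(p1, s1), (p2, s2)}" using ab by auto
    qed
    moreover have "{s1, s2} \<subseteq> Y" using S(1) 2(1) by simp
    ultimately have "R_shape X Y E" unfolding R_shape_def using 2(2,3) by blast
    moreover have "k = 1" using \<open>k \<le> 1\<close> \<open>1 \<le> k\<close> by simp
    ultimately show ?thesis by blast
  qed
qed

lemma stability_closed:
  assumes E: "E \<subseteq> X \<times> Y" and cl: "degree_closed E" and ns: "\<not> spanned (X \<union> Y) E"
    and deg: "\<And>x. x \<in> X \<Longrightarrow> k \<le> card (E `` {x})" "\<And>y. y \<in> Y \<Longrightarrow> k \<le> card (E\<inverse> `` {y})"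
    and n: "(k + 2)\<^sup>2 \<le> n" and miss: "card (X \<times> Y - E) \<le> n * (k + 1)"
    and strict: "k \<ge> 1 \<Longrightarrow> card (X \<times> Y - E) < n * (k + 1)"
  shows "Q_shape k X Y E \<or> Q_shape k Y X (E\<inverse>) \<or> k = 1 \<and> (R_shape X Y E \<or> R_shape Y X (E\<inverse>) \<or>
    (\<forall>x\<in>X. card (E `` {x}) < n) \<and> (\<forall>y\<in>Y. card (E\<inverse> `` {y}) < n))"
proof -
  have nk: "k * k + 4 * k + 4 \<le> n" using n by (simp add: power2_eq_square algebra_simps)
  define S where "S = {y \<in> Y. card (E\<inverse> `` {y}) \<le> k + 1}"
  define T where "T = {x \<in> X. card (E `` {x}) \<le> k + 1}"
  have S: "S \<subseteq> Y" "\<And>y. y \<in> S \<Longrightarrow> card (E\<inverse> `` {y}) \<le> k + 1" by (auto simp: S_def)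
  have T: "T \<subseteq> X" "\<And>x. x \<in> T \<Longrightarrow> card (E `` {x}) \<le> k + 1" by (auto simp: T_def)
  have E': "E\<inverse> \<subseteq> Y \<times> X" using E by auto
  have ns': "\<not> spanned (Y \<union> X) (E\<inverse>)" using ns by (simp add: Un_commute)
  have bigY: "n \<le> card (E\<inverse> `` {y}) + k + 1" if "y \<in> Y - S" for y
    using degree_dichotomy[OF E cl ns _ n miss strict, of y] that by (auto simp: S_def)
  have bigX: "n \<le> card (E `` {x}) + k + 1" if "x \<in> X - T" for x
    using balanced_parts.degree_dichotomy[OF swap E' closed_swap[OF E cl] ns' _ n, of x]
      card_missing_swap miss strict that by (auto simp: T_def)
  have full: "(X - T) \<times> (Y - S) \<subseteq> E"
  proof (rule subrelI, rule ccontr)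
    fix x y assume xy: "(x, y) \<in> (X - T) \<times> (Y - S)" "(x, y) \<notin> E"
    then have "card (E `` {x}) + card (E\<inverse> `` {y}) \<le> n" using cl unfolding degree_closed_def by blast
    then show False using bigX[of x] bigY[of y] xy nk by auto
  qed
  consider "T = {}" | "S = {}" | "S \<noteq> {}" "T \<noteq> {}" by blast
  then show ?thesis
  proof cases
    case 1
    then show ?thesis using one_side_small[OF E cl ns deg(2) n miss S] full by auto
  next
    case 2
    have "Q_shape k Y X (E\<inverse>) \<or> k = 1 \<and> R_shape Y X (E\<inverse>)"
      by (rule balanced_parts.one_side_small[OF swap E' closed_swap[OF E cl] ns' _ n _ T(1)])
        (use deg card_missing_swap miss T full 2 in auto)
    then show ?thesis by blast
  next
    case 3
    then show ?thesis
      using both_sides_small[OF E cl ns deg n miss strict S(1) 3(1) S(2) T(1) 3(2) T(2) full] by blast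
  qed
qed

lemma closed_extension:
  assumes "E \<subseteq> X \<times> Y" "\<not> spanned (X \<union> Y) E"
  obtains F where "E \<subseteq> F" "F \<subseteq> X \<times> Y" "\<not> spanned (X \<union> Y) F" "degree_closed F"
proof -
  let ?\<F> = "{F. E \<subseteq> F \<and> F \<subseteq> X \<times> Y \<and> \<not> spanned (X \<union> Y) F}"
  have "finite ?\<F>" by (rule finite_subset[of _ "Pow (X \<times> Y)"]) auto
  moreover have "E \<in> ?\<F>" using assms by auto
  ultimately obtain F where F: "F \<in> ?\<F>" "\<And>G. G \<in> ?\<F> \<Longrightarrow> F \<subseteq> G \<Longrightarrow> G = F"
    by (metis (no_types, lifting) finite_has_maximal2)
  have "degree_closed F"
    unfolding degree_closed_def
  proof (intro ballI impI)
    fix x y assume xy: "x \<in> X" "y \<in> Y" "(x, y) \<notin> F"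
    then have "spanned (X \<union> Y) (insert (x, y) F)" using F(2)[of "insert (x, y) F"] F(1) by blast
    then show "card (F `` {x}) + card (F\<inverse> `` {y}) \<le> n" using nonadjacent_degree_sum xy F(1) by blast
  qed
  then show ?thesis using that F by blast
qed

text \<open>The degree and edge hypotheses pass up to an edge-maximal supergraph \<open>F\<close>;
  the conclusions, all of them upper bounds, pass back down.\<close>

lemma stability:
  assumes E: "E \<subseteq> X \<times> Y" and ns: "\<not> spanned (X \<union> Y) E"
    and deg: "\<And>x. x \<in> X \<Longrightarrow> k \<le> card (E `` {x})" "\<And>y. y \<in> Y \<Longrightarrow> k \<le> card (E\<inverse> `` {y})"
    and n: "(k + 2)\<^sup>2 \<le> n" and edges: "n * n \<le> card E + n * (k + 1)"
    and strict: "k \<ge> 1 \<Longrightarrow> n * n < card E + n * (k + 1)"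
  shows "Q_shape k X Y E \<or> Q_shape k Y X (E\<inverse>) \<or> k = 1 \<and> (R_shape X Y E \<or> R_shape Y X (E\<inverse>) \<or>
    (\<forall>x\<in>X. card (E `` {x}) < n) \<and> (\<forall>y\<in>Y. card (E\<inverse> `` {y}) < n))"
proof -
  obtain F where F: "E \<subseteq> F" "F \<subseteq> X \<times> Y" "\<not> spanned (X \<union> Y) F" "degree_closed F"
    using closed_extension[OF E ns] .
  have le: "card (E `` {x}) \<le> card (F `` {x})" "card (E\<inverse> `` {x}) \<le> card (F\<inverse> `` {x})" for x
    by (rule card_mono; use finite_nb[OF F(2)] F(1) in auto)+
  have "card E \<le> card F" using F finite_edges by (intro card_mono) auto
  moreover have "card (X \<times> Y - F) + card F = n * n"
    using F(2) finite_edges[OF F(2)] card_mono[OF _ F(2)]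
    by (simp add: card_Diff_subset card_cartesian_product card_parts)
  ultimately have miss: "card (X \<times> Y - F) \<le> n * (k + 1)" "k \<ge> 1 \<Longrightarrow> card (X \<times> Y - F) < n * (k + 1)"
    using edges strict by linarith+
  have "Q_shape k X Y F \<or> Q_shape k Y X (F\<inverse>) \<or> k = 1 \<and> (R_shape X Y F \<or> R_shape Y X (F\<inverse>) \<or>
    (\<forall>x\<in>X. card (F `` {x}) < n) \<and> (\<forall>y\<in>Y. card (F\<inverse> `` {y}) < n))"
    by (rule stability_closed[OF F(2,4,3) _ _ n miss]) (use deg le order_trans in blast)+
  moreover have "Q_shape k X Y F \<Longrightarrow> Q_shape k X Y E" "R_shape X Y F \<Longrightarrow> R_shape X Y E"
    using F(1) Q_shape_mono R_shape_mono by metis+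
  moreover have "E\<inverse> \<subseteq> F\<inverse>" using F(1) by auto
  then have "Q_shape k Y X (F\<inverse>) \<Longrightarrow> Q_shape k Y X (E\<inverse>)" "R_shape Y X (F\<inverse>) \<Longrightarrow> R_shape Y X (E\<inverse>)"
    using Q_shape_mono R_shape_mono by metis+
  ultimately show ?thesis using le le_less_trans by meson
qed

end

section \<open>Signless Laplacian eigenvectors as vertex weightings\<close>

definition lap :: "('a \<times> 'a) set \<Rightarrow> ('a \<Rightarrow> real) \<Rightarrow> 'a \<Rightarrow> real" where
  "lap E f w = (\<Sum>v\<in>(E \<union> E\<inverse>) `` {w}. f w + f v)"

text \<open>The triangle inequality at each edge; it supplies nonnegative test vectors without any
  connectedness.\<close>

lemma lap_abs:
  assumes "lap E f w = \<mu> * f w" "0 \<le> \<mu>"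
  shows "\<mu> * \<bar>f w\<bar> \<le> lap E (\<lambda>v. \<bar>f v\<bar>) w"
proof -
  have "\<mu> * \<bar>f w\<bar> = \<bar>lap E f w\<bar>" using assms by (simp add: abs_mult)
  also have "\<dots> \<le> lap E (\<lambda>v. \<bar>f v\<bar>) w"
    unfolding lap_def by (rule order_trans[OF sum_abs sum_mono]) (rule abs_triangle_ineq)
  finally show ?thesis .
qed

context balanced_parts
begin

lemma finite_sym_nb: "E \<subseteq> X \<times> Y \<Longrightarrow> finite ((E \<union> E\<inverse>) `` {w})"
  using finite_edges[of E] by auto

lemma lap_X: "E \<subseteq> X \<times> Y \<Longrightarrow> x \<in> X \<Longrightarrow> lap E f x = (\<Sum>y\<in>E `` {x}. f x + f y)"
proof -
  assume "E \<subseteq> X \<times> Y" "x \<in> X"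
  then have "(E \<union> E\<inverse>) `` {x} = E `` {x}" using disj by auto
  then show ?thesis by (simp add: lap_def)
qed

lemma lap_Y: "E \<subseteq> X \<times> Y \<Longrightarrow> y \<in> Y \<Longrightarrow> lap E f y = (\<Sum>x\<in>E\<inverse> `` {y}. f y + f x)"
proof -
  assume "E \<subseteq> X \<times> Y" "y \<in> Y"
  then have "(E \<union> E\<inverse>) `` {y} = E\<inverse> `` {y}" using disj by auto
  then show ?thesis by (simp add: lap_def)
qed

text \<open>The factorisation of \<open>D + A\<close> through the vertex-edge incidence matrix, as a
  bilinear form: every edge contributes one term, so deleting or moving an edge has a visible
  effect.\<close>

lemma sum_lap:
  assumes E: "E \<subseteq> X \<times> Y"
  shows "(\<Sum>w\<in>X \<union> Y. z w * lap E f w) = (\<Sum>(a, b)\<in>E. (z a + z b) * (f a + f b))"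
proof -
  have "(\<Sum>w\<in>X. z w * lap E f w) = (\<Sum>x\<in>X. \<Sum>y\<in>E `` {x}. z x * (f x + f y))"
    by (rule sum.cong) (simp_all add: lap_X[OF E] sum_distrib_left)
  also have "\<dots> = (\<Sum>(x, y)\<in>Sigma X (\<lambda>x. E `` {x}). z x * (f x + f y))"
    by (rule sum.Sigma) (use finite_nb[OF E] in auto)
  also have "Sigma X (\<lambda>x. E `` {x}) = E" using E by auto
  finally have 1: "(\<Sum>w\<in>X. z w * lap E f w) = (\<Sum>(a, b)\<in>E. z a * (f a + f b))" .
  have "(\<Sum>w\<in>Y. z w * lap E f w) = (\<Sum>y\<in>Y. \<Sum>x\<in>E\<inverse> `` {y}. z y * (f y + f x))"
    by (rule sum.cong) (simp_all add: lap_Y[OF E] sum_distrib_left)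
  also have "\<dots> = (\<Sum>(y, x)\<in>Sigma Y (\<lambda>y. E\<inverse> `` {y}). z y * (f y + f x))"
    by (rule sum.Sigma) (use finite_nb[OF E] in auto)
  also have "Sigma Y (\<lambda>y. E\<inverse> `` {y}) = prod.swap ` E" using E by force
  also have "(\<Sum>(y, x)\<in>prod.swap ` E. z y * (f y + f x)) = (\<Sum>(a, b)\<in>E. z b * (f a + f b))"
    by (subst sum.reindex) (auto intro!: sum.cong simp: add.commute)
  finally have 2: "(\<Sum>w\<in>Y. z w * lap E f w) = (\<Sum>(a, b)\<in>E. z b * (f a + f b))" .
  have "(\<Sum>w\<in>X \<union> Y. z w * lap E f w) = (\<Sum>w\<in>X. z w * lap E f w) + (\<Sum>w\<in>Y. z w * lap E f w)"
    using disj by (simp add: sum.union_disjoint)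
  then show ?thesis unfolding 1 2 sum.distrib[symmetric]
    by (auto intro!: sum.cong simp: algebra_simps)
qed

lemma sum_lap_sym:
  assumes E: "E \<subseteq> X \<times> Y"
  shows "(\<Sum>w\<in>X \<union> Y. z w * lap E f w) = (\<Sum>w\<in>X \<union> Y. f w * lap E z w)"
  unfolding sum_lap[OF E] by (auto intro!: sum.cong)

lemma lap_mono:
  assumes "E \<subseteq> F" "F \<subseteq> X \<times> Y" "\<And>w. 0 \<le> g w"
  shows "lap E g w \<le> lap F g w"
  unfolding lap_def by (rule sum_mono2) (use assms finite_sym_nb[OF assms(2)] in auto)

text \<open>Weighted summation against an eigenvector \<open>z\<close> turns the inequalities \<open>\<mu> g \<le> lap E g\<close> into
  equalities wherever \<open>z\<close> is positive; zeros of \<open>g\<close> then spread along edges.\<close>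

lemma lap_tight:
  assumes E: "E \<subseteq> X \<times> Y" and z: "\<And>w. 0 \<le> z w" and g: "\<And>w. w \<in> X \<union> Y \<Longrightarrow> \<mu> * g w \<le> lap E g w"
    and le: "(\<Sum>w\<in>X \<union> Y. z w * lap E g w) \<le> \<mu> * (\<Sum>w\<in>X \<union> Y. z w * g w)"
    and w: "w \<in> X \<union> Y" "0 < z w"
  shows "lap E g w = \<mu> * g w"
proof -
  have "(\<Sum>w\<in>X \<union> Y. z w * (lap E g w - \<mu> * g w)) \<le> 0"
    using le by (simp add: algebra_simps sum_subtractf sum_distrib_left)
  moreover have nn: "0 \<le> z w * (lap E g w - \<mu> * g w)" if "w \<in> X \<union> Y" for w
    using z g[OF that] by simp
  ultimately have "(\<Sum>w\<in>X \<union> Y. z w * (lap E g w - \<mu> * g w)) = 0"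
    using sum_nonneg[of "X \<union> Y" "\<lambda>w. z w * (lap E g w - \<mu> * g w)"] by simp
  then have "z w * (lap E g w - \<mu> * g w) = 0"
    using nn w(1) sum_nonneg_eq_0_iff[of "X \<union> Y" "\<lambda>w. z w * (lap E g w - \<mu> * g w)"] by simp
  then show ?thesis using w(2) by simp
qed

lemma lap_zero:
  assumes E: "E \<subseteq> X \<times> Y" and g: "\<And>w. 0 \<le> g w" and w: "lap E g w = \<mu> * g w" "g w = 0"
    and v: "(w, v) \<in> E \<union> E\<inverse>"
  shows "g v = 0"
proof -
  have "(\<Sum>v\<in>(E \<union> E\<inverse>) `` {w}. g v) = 0" using w by (simp add: lap_def)
  then show ?thesis
    using g v finite_sym_nb[OF E, of w] by (subst (asm) sum_nonneg_eq_0_iff) auto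
qed

section \<open>Upper bounds for eigenvalues\<close>

lemma eigenvalue_le_twice_degree:
  assumes E: "E \<subseteq> X \<times> Y" and f: "\<And>w. w \<in> X \<union> Y \<Longrightarrow> lap E f w = \<mu> * f w" "u \<in> X \<union> Y" "f u \<noteq> 0"
    and D: "\<And>w. w \<in> X \<union> Y \<Longrightarrow> card ((E \<union> E\<inverse>) `` {w}) \<le> D" and mu: "0 \<le> \<mu>"
  shows "\<mu> \<le> 2 * real D"
proof -
  define m where "m = Max ((\<lambda>w. \<bar>f w\<bar>) ` (X \<union> Y))"
  have le: "\<bar>f w\<bar> \<le> m" if "w \<in> X \<union> Y" for w using that by (simp add: m_def)
  have "m \<in> (\<lambda>w. \<bar>f w\<bar>) ` (X \<union> Y)" unfolding m_def by (rule Max_in) (use f(2) in auto)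
  then obtain x where x: "x \<in> X \<union> Y" "m = \<bar>f x\<bar>" by auto
  have m0: "0 < m" using le[OF f(2)] f(3) by simp
  have "\<mu> * m \<le> (\<Sum>v\<in>(E \<union> E\<inverse>) `` {x}. \<bar>f x\<bar> + \<bar>f v\<bar>)"
    using lap_abs[OF f(1)[OF x(1)] mu] x by (simp add: lap_def)
  also have "\<dots> \<le> (\<Sum>v\<in>(E \<union> E\<inverse>) `` {x}. m + m)"
    by (intro sum_mono add_mono le) (use x E in auto)
  also have "\<dots> = real (card ((E \<union> E\<inverse>) `` {x})) * (2 * m)" by simp
  also have "\<dots> \<le> real D * (2 * m)" using D[OF x(1)] m0 by simp
  finally have "\<mu> * m \<le> (2 * real D) * m" by (simp add: algebra_simps)
  then show ?thesis using m0 by simp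
qed

text \<open>The bound \<open>\<mu> \<le> max (d u + m u)\<close> (with \<open>m u\<close> the mean degree of the neighbours of \<open>u\<close>) comes
  from looking at the vertex where \<open>\<bar>f\<bar> / d\<close> is maximal.\<close>

lemma eigenvalue_le_degree_plus_mean:
  assumes E: "E \<subseteq> X \<times> Y" and f: "\<And>w. w \<in> X \<union> Y \<Longrightarrow> lap E f w = \<mu> * f w" "u0 \<in> X \<union> Y" "f u0 \<noteq> 0"
    and mu: "0 < \<mu>"
  defines "d \<equiv> \<lambda>w. real (card ((E \<union> E\<inverse>) `` {w}))"
  obtains u where "u \<in> X \<union> Y" "0 < d u" "\<mu> * d u \<le> d u * d u + (\<Sum>v\<in>(E \<union> E\<inverse>) `` {u}. d v)"
proof -
  have nonzero: "0 < d w" if "w \<in> X \<union> Y" "f w \<noteq> 0" for w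
  proof (rule ccontr)
    assume "\<not> ?thesis"
    then have "(E \<union> E\<inverse>) `` {w} = {}" using finite_sym_nb[OF E, of w] by (simp add: d_def card_gt_0_iff)
    then have "lap E f w = 0" unfolding lap_def by (simp only: sum.empty)
    then show False using f(1)[OF that(1)] mu that(2) by simp
  qed
  define t where "t = Max ((\<lambda>w. \<bar>f w\<bar> / d w) ` (X \<union> Y))"
  have le: "\<bar>f w\<bar> / d w \<le> t" if "w \<in> X \<union> Y" for w using that by (simp add: t_def)
  have "t \<in> (\<lambda>w. \<bar>f w\<bar> / d w) ` (X \<union> Y)" unfolding t_def by (rule Max_in) (use f(2) in auto)
  then obtain u where u: "u \<in> X \<union> Y" "t = \<bar>f u\<bar> / d u" by auto
  have "0 < \<bar>f u0\<bar> / d u0" using nonzero[OF f(2,3)] f(3) by simp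
  then have t0: "0 < t" using le[OF f(2)] by linarith
  then have du: "0 < d u" using u by (cases "d u = 0") (auto simp: d_def)
  have fu: "\<bar>f u\<bar> = t * d u" using u du by simp
  have fle: "\<bar>f w\<bar> \<le> t * d w" if "w \<in> X \<union> Y" for w
  proof (cases "f w = 0")
    case True
    then show ?thesis using t0 by (simp add: d_def)
  next
    case False
    then show ?thesis using le[OF that] nonzero[OF that] by (simp add: field_simps)
  qed
  have "\<mu> * (t * d u) \<le> (\<Sum>v\<in>(E \<union> E\<inverse>) `` {u}. \<bar>f u\<bar> + \<bar>f v\<bar>)"
    using lap_abs[OF f(1)[OF u(1)]] mu fu by (simp add: lap_def)
  also have "\<dots> \<le> (\<Sum>v\<in>(E \<union> E\<inverse>) `` {u}. t * d u + t * d v)"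
    by (intro sum_mono add_mono fle) (use u E in auto)
  also have "\<dots> = d u * (t * d u) + t * (\<Sum>v\<in>(E \<union> E\<inverse>) `` {u}. d v)"
    by (simp add: sum.distrib sum_distrib_left d_def)
  finally have "t * (\<mu> * d u) \<le> t * (d u * d u + (\<Sum>v\<in>(E \<union> E\<inverse>) `` {u}. d v))"
    by (simp add: algebra_simps)
  then show ?thesis using that[OF u(1) du] t0 by simp
qed

lemma sum_degrees_X:
  assumes "E \<subseteq> X \<times> Y"
  shows "(\<Sum>x\<in>X. card ((E \<union> E\<inverse>) `` {x})) = card E"
proof -
  have "(\<Sum>x\<in>X. card ((E \<union> E\<inverse>) `` {x})) = (\<Sum>x\<in>X. card (E `` {x}))"
  proof (rule sum.cong)
    fix x assume "x \<in> X"
    then have "(E \<union> E\<inverse>) `` {x} = E `` {x}" using assms disj by auto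
    then show "card ((E \<union> E\<inverse>) `` {x}) = card (E `` {x})" by simp
  qed simp
  also have "\<dots> = card (Sigma X (\<lambda>x. E `` {x}))"
    using finite_nb[OF assms] by (subst card_SigmaI) auto
  also have "Sigma X (\<lambda>x. E `` {x}) = E" using assms by auto
  finally show ?thesis .
qed

text \<open>The neighbours of \<open>u\<close> lie in one part, so their degrees sum to at most
  \<open>e\<close>, and also to at most \<open>D * N\<close>. Thus \<open>\<mu> \<le> D + N\<close>
  and \<open>\<mu> \<le> D + e / D\<close>. The first suffices if \<open>N * D \<le> e\<close>;
  otherwise \<open>e * (N - D) \<le> N * D * (N - D)\<close> turns the second into the
  claim.\<close>

lemma eigenvalue_le_edges:
  assumes E: "E \<subseteq> X \<times> Y" and f: "\<And>w. w \<in> X \<union> Y \<Longrightarrow> lap E f w = \<mu> * f w" "u0 \<in> X \<union> Y" "f u0 \<noteq> 0"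
    and mu: "0 < \<mu>"
  shows "\<mu> * real n \<le> real (card E) + real n * real n"
proof -
  define deg where "deg w = card ((E \<union> E\<inverse>) `` {w})" for w
  obtain u where u: "u \<in> X \<union> Y" "0 < real (deg u)"
    "\<mu> * real (deg u) \<le> real (deg u) * real (deg u) + (\<Sum>v\<in>(E \<union> E\<inverse>) `` {u}. real (deg v))"
    unfolding deg_def by (rule eigenvalue_le_degree_plus_mean[OF E f mu])
  have degX: "(\<Sum>x\<in>X. deg x) = card E" unfolding deg_def by (rule sum_degrees_X[OF E])
  have "E\<inverse> \<subseteq> Y \<times> X" using E by auto
  then have degY: "(\<Sum>y\<in>Y. deg y) = card E"
    using balanced_parts.sum_degrees_X[OF swap, of "E\<inverse>"] by (simp add: deg_def Un_commute card_inverse)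
  have nb: "(E \<union> E\<inverse>) `` {w} \<subseteq> Y \<or> (E \<union> E\<inverse>) `` {w} \<subseteq> X" if "w \<in> X \<union> Y" for w
    using E disj that by blast
  have degn: "deg w \<le> n" if "w \<in> X \<union> Y" for w
    using nb[OF that] card_mono[OF fin(1), of "(E \<union> E\<inverse>) `` {w}"] card_mono[OF fin(2), of "(E \<union> E\<inverse>) `` {w}"]
    by (auto simp: deg_def card_parts)
  have "(\<Sum>v\<in>(E \<union> E\<inverse>) `` {u}. deg v) \<le> (\<Sum>v\<in>(E \<union> E\<inverse>) `` {u}. n)"
    by (rule sum_mono, rule degn) (use E in auto)
  then have "(\<Sum>v\<in>(E \<union> E\<inverse>) `` {u}. deg v) \<le> deg u * n" by (simp add: deg_def)
  then have m1: "(\<Sum>v\<in>(E \<union> E\<inverse>) `` {u}. real (deg v)) \<le> real (deg u) * real n"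
    by (metis of_nat_le_iff of_nat_mult of_nat_sum)
  have "(\<Sum>v\<in>(E \<union> E\<inverse>) `` {u}. deg v) \<le> card E"
    using nb[OF u(1)] sum_mono2[OF fin(1), of "(E \<union> E\<inverse>) `` {u}" deg]
      sum_mono2[OF fin(2), of "(E \<union> E\<inverse>) `` {u}" deg] degX degY by fastforce
  then have m2: "(\<Sum>v\<in>(E \<union> E\<inverse>) `` {u}. real (deg v)) \<le> real (card E)"
    by (metis of_nat_le_iff of_nat_sum)
  define D N e where "D = real (deg u)" and "N = real n" and "e = real (card E)"
  have DN: "0 < D" "D \<le> N" using u(2) degn[OF u(1)] by (simp_all add: D_def N_def)
  have b: "\<mu> * D \<le> D * D + D * N" "\<mu> * D \<le> D * D + e"
    using u(3) m1 m2 by (simp_all add: D_def N_def e_def)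
  show ?thesis unfolding N_def[symmetric] e_def[symmetric]
  proof (cases "N * D \<le> e")
    case True
    have "D * \<mu> \<le> D * (D + N)" using b(1) by (simp add: algebra_simps)
    then have "\<mu> \<le> D + N" using DN by simp
    then have "\<mu> * N \<le> (D + N) * N" using DN by (intro mult_right_mono) auto
    then show "\<mu> * N \<le> e + N * N" using True by (simp add: algebra_simps)
  next
    case False
    then have "e * (N - D) \<le> (N * D) * (N - D)" using DN by (intro mult_right_mono) auto
    moreover have "(\<mu> * D) * N \<le> (D * D + e) * N" using b(2) DN by (intro mult_right_mono) auto
    ultimately have "D * (\<mu> * N) \<le> D * (e + N * N)" by (simp add: algebra_simps)
    then show "\<mu> * N \<le> e + N * N" using DN by simp
  qed
qed

end

text \<open>
  The eigenvalue equations for \<open>q\<close> and the vector taking the values \<open>a\<close>, \<open>b\<close>, \<open>c\<close>, \<open>d\<close> on the four cells of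
  \<open>Q\<^sub>n\<^sup>k\<close>, of sizes \<open>k\<close>, \<open>n - k\<close>, \<open>n - k - 1\<close>, \<open>k + 1\<close>. For \<open>k = 0\<close> the first cell is empty and the last one
  consists of an isolated vertex.
\<close>

definition Q_weights :: "nat \<Rightarrow> nat \<Rightarrow> real \<Rightarrow> real \<Rightarrow> real \<Rightarrow> real \<Rightarrow> real \<Rightarrow> bool" where
  "Q_weights k n q a b c d \<longleftrightarrow>
     0 < a \<and> 0 < b \<and> 0 < c \<and> 0 \<le> d \<and> (1 \<le> k \<longrightarrow> 0 < d) \<and>
     (1 \<le> k \<longrightarrow> q * a = n * a + (real n - k - 1) * c + (k + 1) * d) \<and>
     q * b = (real n - k - 1) * (b + c) \<and>
     q * c = n * c + k * a + (real n - k) * b \<and>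
     q * d = k * (d + a)"

text \<open>With \<open>c = 1\<close>, three of the four equations determine \<open>a\<close>, \<open>b\<close>, \<open>d\<close> in terms of \<open>q\<close>; the
  remaining one has a root to the right of \<open>2 n - k - 1\<close> by the intermediate value theorem.\<close>

lemma Q_weights_exist:
  assumes n: "(k + 2)\<^sup>2 \<le> n"
  obtains q a b c d where "Q_weights k n q a b c d" "2 * real n - k - 1 \<le> q" "1 \<le> k \<Longrightarrow> 2 * real n - k - 1 < q"
proof (cases "k = 0")
  case True
  then have "4 \<le> n" using n by (simp add: power2_eq_square)
  \<comment> \<open>The radius of \<open>K_{n,n-1}\<close>; the first \<open>1\<close> belongs to
    the empty cell.\<close>
  then have "Q_weights k n (2 * real n - 1) 1 ((real n - 1) / n) 1 0"
    using True by (simp add: Q_weights_def field_simps)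
  then show ?thesis using that True by simp
next
  case False
  define K N where "K = real k" and "N = real n"
  have "real ((k + 2)\<^sup>2) \<le> N" using n unfolding N_def by (simp only: of_nat_le_iff)
  then have KN: "(K + 2) * (K + 2) \<le> N" by (simp add: K_def power2_eq_square algebra_simps)
  have K: "1 \<le> K" using False by (simp add: K_def)
  have N2: "4 * K + 4 + K * K \<le> N" using KN by (simp add: algebra_simps)
  then have N1: "4 * K + 4 \<le> N" using zero_le_square[of K] by linarith
  define b where "b q = (N - K - 1) / (q - N + K + 1)" for q
  define a where "a q = (q - N - (N - K) * b q) / K" for q
  \<comment> \<open>\<open>f\<close> is the residual of the remaining equation, the one for the cell
    of size \<open>k\<close>; \<open>b\<close>, \<open>a\<close> and the quotient are solved from
    the other three.\<close>
  define f where "f q = (q - N) * a q - (N - K - 1) - (K + 1) * (K * a q / (q - K))" for q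
  \<comment> \<open>The radius of \<open>K_{n,n-k-1}\<close>, that is, of Q without the edges at the
    last cell; \<open>a\<close> and \<open>b\<close> agree there.\<close>
  define l where "l = 2 * N - K - 1"
  have dl: "0 < q - N + K + 1" "0 < q - K" "0 < q - N" if "l \<le> q" for q
    using that N1 K by (auto simp: l_def)
  have bl: "b l = (N - K - 1) / N" by (simp add: b_def l_def)
  have al: "a l = (N - K - 1) / N" using K N1 unfolding a_def bl by (simp add: l_def field_simps)
  have fl: "f l < 0"
  proof -
    have ln: "l - N = N - K - 1" by (simp add: l_def)
    have "(N - K - 1) * ((N - K - 1) / N) < (N - K - 1) * 1"
      using K N1 by (intro mult_strict_left_mono) (auto simp: field_simps)
    then have "(l - N) * a l < N - K - 1" unfolding al ln by simp
    moreover have "0 \<le> (K + 1) * (K * a l / (l - K))"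
      unfolding al using K N1 dl[of l] by (intro mult_nonneg_nonneg divide_nonneg_nonneg) auto
    ultimately show ?thesis unfolding f_def by linarith
  qed
  have b_mono: "b q \<le> b l" if "l \<le> q" for q
    unfolding b_def by (rule divide_left_mono) (use that dl[of q] dl[of l] N1 K in auto)
  \<comment> \<open>Far enough to the right that \<open>a r \<ge> 1\<close> and that the last term
    of \<open>f r\<close> is at most \<open>a r\<close>.\<close>
  define r where "r = 3 * N"
  have lr: "l \<le> r" using N1 K by (simp add: l_def r_def)
  have fr: "0 \<le> f r"
  proof -
    have "b l \<le> 1" unfolding bl using N1 K by (simp add: field_simps)
    then have "b r \<le> 1" using b_mono[OF lr] by linarith
    then have "(N - K) * b r \<le> (N - K) * 1" using N1 K by (intro mult_left_mono) auto
    then have "K * a r \<ge> N + K" using K by (simp add: a_def r_def)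
    moreover have "K * 1 \<le> N + K" using N1 K by simp
    ultimately have "K * 1 \<le> K * a r" by linarith
    then have ar: "1 \<le> a r" using K by simp
    have "(K + 1) * (K * a r / (r - K)) = (K + 1) * K / (r - K) * a r" by simp
    also have "\<dots> \<le> 1 * a r"
    proof (rule mult_right_mono)
      have "(K + 1) * K \<le> r - K" using N1 N2 K by (simp add: r_def algebra_simps)
      then show "(K + 1) * K / (r - K) \<le> 1" using dl[OF lr] by simp
    qed (use ar in simp)
    finally have 1: "(K + 1) * (K * a r / (r - K)) \<le> a r" by simp
    have "(2 * N - 1) * 1 \<le> (2 * N - 1) * a r" using ar N1 K by (intro mult_left_mono) auto
    then show ?thesis using 1 N1 K unfolding f_def by (simp add: r_def algebra_simps)
  qed
  have cont: "continuous_on {l..r} f"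
    unfolding f_def a_def b_def using K dl by (intro continuous_intros) fastforce+
  obtain q where q: "l \<le> q" "q \<le> r" "f q = 0" using IVT'[OF less_imp_le[OF fl] fr lr cont] by blast
  have ql: "l < q" using q fl by (cases "l = q") auto
  have bq: "0 < b q" unfolding b_def using dl[OF q(1)] N1 K by (intro divide_pos_pos) auto
  have aq: "0 < a q"
  proof -
    have "(N - K) * b q \<le> (N - K) * b l" using b_mono[OF q(1)] N1 K by (intro mult_left_mono) auto
    also have "\<dots> = (N - K - 1) * ((N - K) / N)" unfolding bl by simp
    also have "\<dots> < (N - K - 1) * 1"
      using N1 K by (intro mult_strict_left_mono) (auto simp: field_simps)
    also have "\<dots> = l - N" by (simp add: l_def)
    finally show ?thesis using q(1) K by (simp add: a_def)
  qed
  define d where "d = K * a q / (q - K)"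
  have dq: "0 < d" unfolding d_def using aq K dl[OF q(1)] by (intro divide_pos_pos mult_pos_pos) auto
  have "q * d = K * (d + a q)" using dl[OF q(1)] by (simp add: d_def field_simps)
  moreover have "q * 1 = N * 1 + K * a q + (N - K) * b q" using K by (simp add: a_def)
  moreover have "q * b q = (N - K - 1) * (b q + 1)"
  proof -
    have "(q - N + K + 1) * b q = N - K - 1" using dl[OF q(1)] by (simp add: b_def)
    then show ?thesis by (simp add: algebra_simps)
  qed
  moreover have "q * a q = N * a q + (N - K - 1) * 1 + (K + 1) * d"
    using q(3) by (simp add: f_def d_def algebra_simps)
  ultimately have "Q_weights k n q (a q) (b q) 1 d"
    using aq bq dq unfolding Q_weights_def K_def N_def by simp
  then show ?thesis using that ql by (simp add: l_def K_def N_def)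
qed

definition Q_edges :: "'a set \<Rightarrow> 'a set \<Rightarrow> 'a set \<Rightarrow> 'a set \<Rightarrow> ('a \<times> 'a) set" where
  "Q_edges X Y W S = X \<times> (Y - S) \<union> W \<times> S"

definition Q_vector :: "'a set \<Rightarrow> 'a set \<Rightarrow> 'a set \<Rightarrow> real \<Rightarrow> real \<Rightarrow> real \<Rightarrow> real \<Rightarrow> 'a \<Rightarrow> real" where
  "Q_vector X W S a b c d w = (if w \<in> W then a else if w \<in> S then d else if w \<in> X then b else c)"

locale Q_parts = balanced_parts X Y n for X Y :: "'a set" and n +
  fixes W S :: "'a set" and k :: nat and q a b c d :: real
  assumes WX: "W \<subseteq> X" and SY: "S \<subseteq> Y" and cW: "card W = k" and cS: "card S = k + 1"
    and n: "(k + 2)\<^sup>2 \<le> n" and weights: "Q_weights k n q a b c d" and q: "2 * real n - k - 1 \<le> q"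
begin

abbreviation "EQ \<equiv> Q_edges X Y W S"
abbreviation "z \<equiv> Q_vector X W S a b c d"

lemma EQ: "EQ \<subseteq> X \<times> Y" using WX SY by (auto simp: Q_edges_def)

lemma finite_WS: "finite W" "finite S" using WX SY fin finite_subset by blast+

lemma nk: "4 * k + 4 \<le> n" using n by (simp add: power2_eq_square algebra_simps)

lemma q_gt: "real n < q" "real k < q" "0 < q" using q nk by linarith+

lemma z_vals: "w \<in> W \<Longrightarrow> z w = a" "w \<in> X - W \<Longrightarrow> z w = b" "w \<in> S \<Longrightarrow> z w = d" "w \<in> Y - S \<Longrightarrow> z w = c"
  using WX SY disj by (auto simp: Q_vector_def)

lemma pos: "0 < a" "0 < b" "0 < c" "0 \<le> d" "1 \<le> k \<Longrightarrow> 0 < d"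
  using weights by (auto simp: Q_weights_def)

lemma z_nonneg: "0 \<le> z w" using pos by (simp add: Q_vector_def)

text \<open>For \<open>k = 0\<close> the weight on \<open>S\<close> is zero, which is why positivity
  splits in two.\<close>

lemma z_pos: "w \<in> X \<union> (Y - S) \<Longrightarrow> 0 < z w" "1 \<le> k \<Longrightarrow> 0 < z w"
  using pos SY disj by (auto simp: Q_vector_def)

lemma cards: "real (card (X - W)) = real n - k" "real (card (Y - S)) = real n - k - 1"
  using WX SY finite_WS cW cS nk by (simp_all add: card_Diff_subset card_parts of_nat_diff)

lemma sum_split:
  "(\<Sum>x\<in>X. g x) = (\<Sum>x\<in>W. g x) + (\<Sum>x\<in>X - W. g x)" "(\<Sum>x\<in>Y. g x) = (\<Sum>x\<in>S. g x) + (\<Sum>x\<in>Y - S. g x)"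
  for g :: "'a \<Rightarrow> real"
  using sum.subset_diff[OF WX fin(1), of g] sum.subset_diff[OF SY fin(2), of g] by simp_all

lemma sum_const_on: "(\<And>x. x \<in> A \<Longrightarrow> g x = r) \<Longrightarrow> (\<Sum>x\<in>A. s + g x) = real (card A) * (s + r)"
  for g :: "'a \<Rightarrow> real"
  by simp

lemma lap_z:
  assumes "w \<in> X \<union> Y"
  shows "lap EQ z w = q * z w"
proof -
  have eqs: "1 \<le> k \<Longrightarrow> q * a = n * a + (real n - k - 1) * c + (k + 1) * d"
    "q * b = (real n - k - 1) * (b + c)" "q * c = n * c + k * a + (real n - k) * b"
    "q * d = k * (d + a)"
    using weights by (auto simp: Q_weights_def)
  consider "w \<in> W" | "w \<in> X - W" | "w \<in> S" | "w \<in> Y - S" using assms by blast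
  then show ?thesis
  proof cases
    case 1
    then have "EQ `` {w} = Y" using WX SY by (auto simp: Q_edges_def)
    then have "lap EQ z w = (\<Sum>y\<in>Y. a + z y)" using lap_X[OF EQ, of w] 1 WX z_vals(1) by auto
    also have "\<dots> = real (card S) * (a + d) + real (card (Y - S)) * (a + c)"
      unfolding sum_split using z_vals by (simp add: sum_const_on)
    also have "\<dots> = q * a"
    proof -
      have "1 \<le> k" using cW 1 finite_WS by (auto simp: Suc_le_eq card_gt_0_iff)
      then show ?thesis using eqs(1) unfolding cards cS by (simp add: algebra_simps)
    qed
    finally show ?thesis using z_vals 1 by simp
  next
    case 2
    then have "EQ `` {w} = Y - S" using WX SY by (auto simp: Q_edges_def)
    then have "lap EQ z w = (\<Sum>y\<in>Y - S. b + z y)" using lap_X[OF EQ, of w] 2 z_vals(2) by auto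
    also have "\<dots> = real (card (Y - S)) * (b + c)" using z_vals by (intro sum_const_on) auto
    finally show ?thesis using z_vals 2 eqs unfolding cards by simp
  next
    case 3
    then have "EQ\<inverse> `` {w} = W" using WX SY disj by (auto simp: Q_edges_def)
    then have "lap EQ z w = (\<Sum>y\<in>W. d + z y)" using lap_Y[OF EQ, of w] 3 SY z_vals(3) by auto
    also have "\<dots> = real (card W) * (d + a)" using z_vals by (intro sum_const_on) auto
    finally show ?thesis using z_vals 3 eqs cW by simp
  next
    case 4
    then have "EQ\<inverse> `` {w} = X" using WX SY disj by (auto simp: Q_edges_def)
    then have "lap EQ z w = (\<Sum>y\<in>X. c + z y)" using lap_Y[OF EQ, of w] 4 z_vals(4) by auto
    also have "\<dots> = real (card W) * (c + a) + real (card (X - W)) * (c + b)"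
      unfolding sum_split using z_vals by (simp add: sum_const_on)
    also have "\<dots> = q * c" using eqs(3) unfolding cards cW by (simp add: algebra_simps)
    finally show ?thesis using z_vals 4 by simp
  qed
qed

section \<open>Spectral comparison with Q\<close>

lemma form_EQ: "(\<Sum>(x, y)\<in>EQ. (z x + z y) * (g x + g y)) = q * (\<Sum>w\<in>X \<union> Y. z w * g w)"
proof -
  have "(\<Sum>w\<in>X \<union> Y. z w * lap EQ g w) = (\<Sum>w\<in>X \<union> Y. g w * (q * z w))"
    unfolding sum_lap_sym[OF EQ, of z] using lap_z by (intro sum.cong) auto
  then show ?thesis unfolding sum_lap[OF EQ] by (simp add: sum_distrib_left mult_ac)
qed

lemma YS_nonempty: "\<exists>y. y \<in> Y - S"
proof -
  have "real (card (Y - S)) > 0" unfolding cards using nk by linarith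
  then show ?thesis by (metis card.empty ex_in_conv of_nat_0 order_less_irrefl)
qed

text \<open>Pairing the inequalities for \<open>g\<close> with \<open>z\<close> gives
  \<open>\<mu> * ?s \<le> q * ?s\<close> minus the terms of the missing edges. As
  \<open>q \<le> \<mu>\<close>, those terms vanish, so \<open>g\<close> is zero at both ends of a
  missing edge. The inequalities become equalities where \<open>z > 0\<close>, and the zeros spread
  until \<open>g\<close> vanishes everywhere.\<close>

lemma Q_unique:
  assumes E: "E \<subseteq> EQ" and g: "\<And>w. 0 \<le> g w" and sub: "\<And>w. w \<in> X \<union> Y \<Longrightarrow> \<mu> * g w \<le> lap E g w"
    and u: "u \<in> X \<union> Y" "g u \<noteq> 0" and mu: "q \<le> \<mu>"
  shows "E = EQ"
proof (rule ccontr)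
  assume "E \<noteq> EQ"
  then obtain x0 y0 where e: "(x0, y0) \<in> EQ - E" using E by auto
  have EXY: "E \<subseteq> X \<times> Y" using E EQ by blast
  let ?F = "\<lambda>(x, y). (z x + z y) * (g x + g y)"
  let ?s = "\<Sum>w\<in>X \<union> Y. z w * g w"
  have nnF: "0 \<le> ?F e" for e using z_nonneg g by (cases e) (auto intro: mult_nonneg_nonneg add_nonneg_nonneg)
  have finQ: "finite EQ" by (rule finite_edges[OF EQ])
  have s: "0 \<le> ?s" using z_nonneg g by (intro sum_nonneg) simp
  have subQ: "\<mu> * g w \<le> lap EQ g w" if "w \<in> X \<union> Y" for w
    using sub[OF that] lap_mono[where g = g, OF E EQ g] by (meson order_trans)
  have "\<mu> * ?s = (\<Sum>w\<in>X \<union> Y. z w * (\<mu> * g w))" by (simp add: sum_distrib_left mult_ac)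
  also have "\<dots> \<le> (\<Sum>w\<in>X \<union> Y. z w * lap E g w)"
    using sub z_nonneg by (intro sum_mono mult_left_mono) auto
  also have "\<dots> = sum ?F E" by (rule sum_lap[OF EXY])
  finally have 1: "\<mu> * ?s \<le> sum ?F E" .
  have "sum ?F EQ = sum ?F (EQ - E) + sum ?F E" by (rule sum.subset_diff[OF E finQ])
  moreover have 2: "q * ?s \<le> \<mu> * ?s" using mu s by (intro mult_right_mono)
  ultimately have "sum ?F (EQ - E) \<le> 0" using 1 form_EQ[of g] by linarith
  moreover have "?F (x0, y0) \<le> sum ?F (EQ - E)" using e finQ nnF by (intro member_le_sum) auto
  ultimately have F0: "(z x0 + z y0) * (g x0 + g y0) = 0" using nnF[of "(x0, y0)"] unfolding prod.case by linarith
  have x0: "x0 \<in> X" "y0 \<in> Y" using e EQ by auto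
  have "0 < z x0 + z y0" using z_pos(1)[of x0] z_nonneg[of y0] x0 by simp
  then have g0: "g x0 = 0" "g y0 = 0" using F0 g[of x0] g[of y0] by auto
  have tight: "lap EQ g w = \<mu> * g w" if "w \<in> X \<union> (Y - S)" for w
  proof (rule lap_tight[OF EQ z_nonneg subQ])
    show "(\<Sum>w\<in>X \<union> Y. z w * lap EQ g w) \<le> \<mu> * ?s" using form_EQ[of g] 2 unfolding sum_lap[OF EQ] by simp
  qed (use that z_pos in auto)
  have spread: "g v = 0" if "w \<in> X \<union> (Y - S)" "g w = 0" "(w, v) \<in> EQ \<union> EQ\<inverse>" for v w
    using lap_zero[where g = g, OF EQ g tight[OF that(1)] that(2,3)] .
  obtain y1 where y1: "y1 \<in> Y - S" using YS_nonempty by blast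
  have "g y1 = 0" using spread[of x0 y1] x0 g0 y1 by (auto simp: Q_edges_def)
  then have gX: "g x = 0" if "x \<in> X" for x using spread[of y1 x] y1 that by (auto simp: Q_edges_def)
  have gB: "g y = 0" if "y \<in> Y - S" for y using spread[of x0 y] x0 g0 that by (auto simp: Q_edges_def)
  \<comment> \<open>Where \<open>z\<close> may vanish no equality is available; with
    \<open>g\<close> already zero on \<open>X\<close>, the inequality alone suffices since
    \<open>\<mu> > k\<close>.\<close>
  have gS: "g s = 0" if s: "s \<in> S" for s
  proof -
    have "EQ\<inverse> `` {s} = W" using s SY by (auto simp: Q_edges_def)
    then have "lap EQ g s = (\<Sum>x\<in>W. g s + g x)" using lap_Y[OF EQ, of s g] s SY by auto
    also have "\<dots> = real k * g s" using gX WX cW by (subst sum_const_on[of _ _ 0]) auto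
    finally have "\<mu> * g s \<le> k * g s" using subQ[of s] s SY by auto
    then have "(\<mu> - k) * g s \<le> 0" by (simp add: algebra_simps)
    moreover have "0 < \<mu> - k" using mu q_gt by simp
    ultimately show ?thesis using g[of s] by (simp add: mult_le_0_iff)
  qed
  show False using u gX gB gS by blast
qed

lemma a_gt_b: "1 \<le> k \<Longrightarrow> b < a"
proof -
  assume k: "1 \<le> k"
  have eq: "(q - n) * a = (real n - k - 1) * c + (k + 1) * d" "(q - n + k + 1) * b = (real n - k - 1) * c"
    using weights k by (auto simp: Q_weights_def algebra_simps)
  have "(q - n) * b < (q - n + k + 1) * b" using pos(2) by (intro mult_strict_right_mono) auto
  also have "\<dots> \<le> (q - n) * a" unfolding eq using pos(4) by simp
  finally show ?thesis using q_gt by simp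
qed

text \<open>Moving the edge \<open>p1 s2\<close> of Q to \<open>p2 s2\<close> lowers the form by at
  least \<open>(a - b) * (g p1 + g s2)\<close>, because \<open>z p1 = a\<close>,
  \<open>z p2 = b\<close> with \<open>b < a\<close>, and \<open>g p2 \<le> g p1\<close>. With
  \<open>q \<le> \<mu>\<close> this loss must be zero, so \<open>g\<close> vanishes at
  \<open>p1\<close> and \<open>s2\<close>, and the zeros spread as in
  \<open>Q_unique\<close>.\<close>

lemma R_impossible_ordered:
  assumes k: "k = 1" "W = {p1}" "S = {s1, s2}" "s1 \<noteq> s2" "p2 \<in> X" "p1 \<noteq> p2"
    and g: "\<And>w. 0 \<le> g w" and ge: "g p2 \<le> g p1"
    and sub: "\<And>w. w \<in> X \<union> Y \<Longrightarrow> \<mu> * g w \<le> lap (X \<times> (Y - S) \<union> {(p1, s1), (p2, s2)}) g w"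
    and u: "u \<in> X \<union> Y" "g u \<noteq> 0" and mu: "q \<le> \<mu>"
  shows False
proof -
  define D where "D = X \<times> (Y - S) \<union> {(p1, s1)}"
  have finD: "finite D" by (simp add: D_def)
  have EQ_D: "EQ = insert (p1, s2) D" by (auto simp: Q_edges_def D_def k)
  define ER where "ER = X \<times> (Y - S) \<union> {(p1, s1), (p2, s2)}"
  have ER_D: "ER = insert (p2, s2) D" by (auto simp: ER_def D_def)
  have notD: "(p1, s2) \<notin> D" "(p2, s2) \<notin> D" using k by (auto simp: D_def)
  have p: "p1 \<in> X" "s1 \<in> Y" "s2 \<in> Y" using WX SY k by auto
  have ER: "ER \<subseteq> X \<times> Y" using p k by (auto simp: ER_def)
  let ?F = "\<lambda>(x, y). (z x + z y) * (g x + g y)"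
  let ?s = "\<Sum>w\<in>X \<union> Y. z w * g w"
  have s: "0 \<le> ?s" using z_nonneg g by (intro sum_nonneg) simp
  have vals: "z p1 = a" "z p2 = b" "z s2 = d" using z_vals k by auto
  have "\<mu> * ?s = (\<Sum>w\<in>X \<union> Y. z w * (\<mu> * g w))" by (simp add: sum_distrib_left mult_ac)
  also have "\<dots> \<le> (\<Sum>w\<in>X \<union> Y. z w * lap ER g w)"
    using sub z_nonneg unfolding ER_def by (intro sum_mono mult_left_mono) auto
  also have "\<dots> = sum ?F ER" by (rule sum_lap[OF ER])
  finally have 1: "\<mu> * ?s \<le> sum ?F ER" .
  have 2: "q * ?s \<le> \<mu> * ?s" using mu s by (intro mult_right_mono)
  have 3: "sum ?F EQ = sum ?F D + (a + d) * (g p1 + g s2)" "sum ?F ER = sum ?F D + (b + d) * (g p2 + g s2)"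
    unfolding EQ_D ER_D using notD finD vals by simp_all
  have "(b + d) * (g p2 + g s2) \<le> (b + d) * (g p1 + g s2)"
    using ge pos by (intro mult_left_mono) auto
  then have 4: "sum ?F ER + (a - b) * (g p1 + g s2) \<le> sum ?F EQ" using 3 by (simp add: algebra_simps)
  have ab: "0 < a - b" using a_gt_b k by simp
  have nn: "0 \<le> (a - b) * (g p1 + g s2)" using ab g by simp
  then have "(a - b) * (g p1 + g s2) = 0" using 1 2 4 form_EQ[of g] by linarith
  then have g0: "g p1 = 0" "g s2 = 0" using ab g[of p1] g[of s2] by auto
  have tight: "lap ER g w = \<mu> * g w" if "w \<in> X \<union> Y" for w
  proof (rule lap_tight[OF ER z_nonneg])
    show "(\<Sum>w\<in>X \<union> Y. z w * lap ER g w) \<le> \<mu> * ?s"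
      using form_EQ[of g] 2 4 nn unfolding sum_lap[OF ER] by linarith
    show "\<mu> * g w \<le> lap ER g w" if "w \<in> X \<union> Y" for w using sub[OF that] by (simp add: ER_def)
  qed (use that z_pos k in auto)
  have spread: "g v = 0" if "w \<in> X \<union> Y" "g w = 0" "(w, v) \<in> ER \<union> ER\<inverse>" for v w
    using lap_zero[where g = g, OF ER g tight[OF that(1)] that(2,3)] .
  obtain y1 where y1: "y1 \<in> Y - S" using YS_nonempty by blast
  have gB: "g y = 0" if "y \<in> Y - S" for y using spread[of p1 y] p g0 that by (auto simp: ER_def)
  have gX: "g x = 0" if "x \<in> X" for x using spread[of y1 x] y1 that gB[OF y1] by (auto simp: ER_def)
  have "g s1 = 0" using spread[of p1 s1] p g0 by (auto simp: ER_def)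
  then show False using u gX gB g0 k(3) by blast
qed

end

section \<open>From matrices to vertex weightings\<close>

lemma graph_of_simps [simp]:
  "verts (graph_of B) = part_X B \<union> part_Y B"
  "arcs_ends (graph_of B) = edges_XY B \<union> (edges_XY B)\<inverse>"
  by (simp_all add: graph_of_def)

lemma out_degree_graph_of: "out_degree (graph_of B) w = card ((edges_XY B \<union> (edges_XY B)\<inverse>) `` {w})"
proof -
  have "out_arcs (graph_of B) w = Pair w ` ((edges_XY B \<union> (edges_XY B)\<inverse>) `` {w})"
    by (auto simp: out_arcs_def graph_of_def)
  then show ?thesis by (simp add: out_degree_def card_image inj_on_def)
qed

lemma traceable_graph_of:
  assumes "spanned (part_X B \<union> part_Y B) (edges_XY B)" "part_X B \<union> part_Y B \<noteq> {}"
  shows "traceable (graph_of B)"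
proof -
  obtain p where p: "distinct p" "set p = part_X B \<union> part_Y B"
    "successively (\<lambda>u v. (u, v) \<in> edges_XY B \<union> (edges_XY B)\<inverse>) p"
    using assms(1) by (auto simp: spanned_def)
  have "set (vwalk_arcs p) \<subseteq> A" if "successively (\<lambda>u v. (u, v) \<in> A) p" for A and p :: "'a list"
    using that by (induction p rule: vwalk_arcs.induct) auto
  from this[OF p(3)] have "vpath p (graph_of B)"
    using p assms(2) by (auto simp: vpath_def vwalk_def)
  then show ?thesis using p(2) by (auto simp: traceable_def)
qed

lemma signless_laplacian_mult:
  assumes vs: "distinct vs" "set vs = verts (graph_of B)" and B: "bipartite_graph B"
    and v: "v \<in> carrier_vec (length vs)" "\<And>j. j < length vs \<Longrightarrow> v $ j = f (vs ! j)" and i: "i < length vs"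
  shows "(signless_laplacian (graph_of B) vs *\<^sub>v v) $ i = lap (edges_XY B) f (vs ! i)"
proof -
  let ?N = "length vs" and ?G = "graph_of B"
  let ?A = "edges_XY B \<union> (edges_XY B)\<inverse>"
  have fA: "finite (?A `` {vs ! i})" and subA: "?A `` {vs ! i} \<subseteq> set vs"
  proof -
    show "?A `` {vs ! i} \<subseteq> set vs" using B vs(2) by (auto simp: bipartite_graph_def)
    then show "finite (?A `` {vs ! i})" by (rule finite_subset) simp
  qed
  have bij: "bij_betw ((!) vs) {0..<?N} (set vs)"
    using vs(1) by (metis bij_betw_nth atLeast0LessThan)
  have "(signless_laplacian ?G vs *\<^sub>v v) $ i =
      (\<Sum>j\<in>{0..<?N}. ((if i = j then real (out_degree ?G (vs ! i)) else 0)
        + (if (vs ! i, vs ! j) \<in> ?A then 1 else 0)) * f (vs ! j))"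
    using i v by (simp add: signless_laplacian_def degree_matrix_def adjacency_matrix_def scalar_prod_def)
  also have "\<dots> = (\<Sum>j\<in>{0..<?N}. if i = j then real (out_degree ?G (vs ! i)) * f (vs ! j) else 0)
      + (\<Sum>j\<in>{0..<?N}. if (vs ! i, vs ! j) \<in> ?A then f (vs ! j) else 0)"
    unfolding sum.distrib[symmetric] by (rule sum.cong) (auto simp: algebra_simps)
  also have "(\<Sum>j\<in>{0..<?N}. if i = j then real (out_degree ?G (vs ! i)) * f (vs ! j) else 0)
      = real (out_degree ?G (vs ! i)) * f (vs ! i)"
    using i by simp
  also have "(\<Sum>j\<in>{0..<?N}. if (vs ! i, vs ! j) \<in> ?A then f (vs ! j) else 0)
      = (\<Sum>w\<in>set vs. if (vs ! i, w) \<in> ?A then f w else 0)"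
    by (rule sum.reindex_bij_betw[OF bij])
  also have "\<dots> = (\<Sum>w\<in>?A `` {vs ! i}. f w)"
    using subA by (intro sum.mono_neutral_cong_right) auto
  finally show ?thesis by (simp add: lap_def sum.distrib out_degree_graph_of)
qed

lemma eigenvalue_signless_laplacian:
  assumes vs: "distinct vs" "set vs = verts (graph_of B)" and B: "bipartite_graph B"
  shows "eigenvalue (signless_laplacian (graph_of B) vs) \<mu> \<longleftrightarrow>
    (\<exists>f. (\<exists>w\<in>part_X B \<union> part_Y B. f w \<noteq> 0) \<and>
      (\<forall>w\<in>part_X B \<union> part_Y B. lap (edges_XY B) f w = \<mu> * f w))"
proof -
  let ?N = "length vs" and ?A = "signless_laplacian (graph_of B) vs" and ?V = "part_X B \<union> part_Y B"
  have dim: "dim_row ?A = ?N" by (simp add: signless_laplacian_def adjacency_matrix_def)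
  have V: "?V = set vs" using vs by simp
  show ?thesis
  proof
    assume "eigenvalue ?A \<mu>"
    then obtain v where v: "v \<in> carrier_vec ?N" "v \<noteq> 0\<^sub>v ?N" "?A *\<^sub>v v = \<mu> \<cdot>\<^sub>v v"
      by (auto simp: eigenvalue_def eigenvector_def dim)
    define f where "f w = v $ (THE j. j < ?N \<and> vs ! j = w)" for w
    have the: "(THE j. j < ?N \<and> vs ! j = vs ! i) = i" if "i < ?N" for i
      using that vs(1) by (intro the_equality) (auto simp: nth_eq_iff_index_eq)
    have f: "v $ j = f (vs ! j)" if "j < ?N" for j using the[OF that] by (simp add: f_def)
    have "lap (edges_XY B) f w = \<mu> * f w" if "w \<in> ?V" for w
    proof -
      obtain i where i: "i < ?N" "w = vs ! i" using \<open>w \<in> ?V\<close> unfolding V by (auto simp: in_set_conv_nth)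
      show ?thesis
        using signless_laplacian_mult[OF vs B v(1) f i(1)] v(1,3) i f by simp
    qed
    moreover have "\<exists>w\<in>?V. f w \<noteq> 0"
    proof (rule ccontr)
      assume "\<not> ?thesis"
      then have "v $ j = 0" if "j < ?N" for j using f that unfolding V by auto
      then have "v = 0\<^sub>v ?N" using v(1) by (intro eq_vecI) auto
      then show False using v(2) by simp
    qed
    ultimately show "\<exists>f. (\<exists>w\<in>?V. f w \<noteq> 0) \<and> (\<forall>w\<in>?V. lap (edges_XY B) f w = \<mu> * f w)" by blast
  next
    assume "\<exists>f. (\<exists>w\<in>?V. f w \<noteq> 0) \<and> (\<forall>w\<in>?V. lap (edges_XY B) f w = \<mu> * f w)"
    then obtain f w where f: "w \<in> ?V" "f w \<noteq> 0" "\<And>w. w \<in> ?V \<Longrightarrow> lap (edges_XY B) f w = \<mu> * f w"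
      by blast
    define v where "v = vec ?N (\<lambda>j. f (vs ! j))"
    have v: "v \<in> carrier_vec ?N" "\<And>j. j < ?N \<Longrightarrow> v $ j = f (vs ! j)" by (auto simp: v_def)
    have "?A *\<^sub>v v = \<mu> \<cdot>\<^sub>v v"
    proof (rule eq_vecI)
      fix i assume "i < dim_vec (\<mu> \<cdot>\<^sub>v v)"
      then have i: "i < ?N" using v by simp
      then have "vs ! i \<in> ?V" unfolding V by simp
      then show "(?A *\<^sub>v v) $ i = (\<mu> \<cdot>\<^sub>v v) $ i"
        using signless_laplacian_mult[OF vs B v i] f(3) i v by simp
    qed (use v dim in simp)
    moreover have "v \<noteq> 0\<^sub>v ?N"
    proof -
      obtain i where "i < ?N" "w = vs ! i" using f(1) unfolding V by (auto simp: in_set_conv_nth)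
      then show ?thesis using f(2) v(2) by (metis index_zero_vec(1))
    qed
    ultimately have "eigenvector ?A v \<mu>" unfolding eigenvector_def dim using v(1) by blast
    then show "eigenvalue ?A \<mu>" unfolding eigenvalue_def by blast
  qed
qed

section \<open>The spectral radius as a maximum over vertex weightings\<close>

lemma vertex_list_graph_of:
  assumes "bipartite_graph B"
  shows "distinct (vertex_list (graph_of B)) \<and> set (vertex_list (graph_of B)) = verts (graph_of B)"
proof -
  have "finite (verts (graph_of B))" using assms by (simp add: bipartite_graph_def)
  then obtain vs where "distinct vs \<and> set vs = verts (graph_of B)" using finite_distinct_list by blast
  then show ?thesis unfolding vertex_list_def by (rule someI)
qed

definition lap_eigenvalue :: "'a bigraph \<Rightarrow> real \<Rightarrow> bool" where
  "lap_eigenvalue B \<mu> \<longleftrightarrow> (\<exists>f. (\<exists>w\<in>part_X B \<union> part_Y B. f w \<noteq> 0) \<and>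
      (\<forall>w\<in>part_X B \<union> part_Y B. lap (edges_XY B) f w = \<mu> * f w))"

lemma eigenvalue_iff_lap_eigenvalue:
  assumes "bipartite_graph B"
  shows "eigenvalue (signless_laplacian (graph_of B) (vertex_list (graph_of B))) \<mu> \<longleftrightarrow> lap_eigenvalue B \<mu>"
  using vertex_list_graph_of[OF assms] eigenvalue_signless_laplacian[OF _ _ assms]
  unfolding lap_eigenvalue_def by blast

lemma signless_spectral_radius_eq:
  assumes "bipartite_graph B"
  shows "signless_spectral_radius (graph_of B) = Max {\<mu>. lap_eigenvalue B \<mu>}"
  by (simp add: signless_spectral_radius_def eigenvalue_iff_lap_eigenvalue[OF assms])

lemma finite_lap_eigenvalues:
  assumes B: "bipartite_graph B"
  shows "finite {\<mu>. lap_eigenvalue B \<mu>}"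
proof -
  let ?vs = "vertex_list (graph_of B)"
  let ?A = "signless_laplacian (graph_of B) ?vs"
  have A: "?A \<in> carrier_mat (length ?vs) (length ?vs)"
    by (simp add: signless_laplacian_def adjacency_matrix_def degree_matrix_def)
  have "{\<mu>. lap_eigenvalue B \<mu>} = {\<mu>. poly (char_poly ?A) \<mu> = 0}"
    unfolding eigenvalue_iff_lap_eigenvalue[OF B, symmetric] eigenvalue_root_char_poly[OF A] ..
  also have "finite \<dots>"
    using degree_monic_char_poly[OF A] by (intro poly_roots_finite) auto
  finally show ?thesis .
qed

text \<open>The vector that is \<open>1\<close> on one part and \<open>-1\<close> on the other lies in the kernel, so the maximum
  defining the spectral radius is taken over a nonempty set.\<close>

lemma lap_eigenvalue_0:
  assumes "bipartite_graph B" "part_X B \<union> part_Y B \<noteq> {}"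
  shows "lap_eigenvalue B 0"
  unfolding lap_eigenvalue_def
proof (intro exI conjI)
  let ?f = "\<lambda>w. if w \<in> part_X B then 1 else -1 :: real"
  show "\<exists>w\<in>part_X B \<union> part_Y B. ?f w \<noteq> 0" using assms(2) by auto
  show "\<forall>w\<in>part_X B \<union> part_Y B. lap (edges_XY B) ?f w = 0 * ?f w"
  proof
    fix w assume w: "w \<in> part_X B \<union> part_Y B"
    have "?f w + ?f v = 0" if "v \<in> (edges_XY B \<union> (edges_XY B)\<inverse>) `` {w}" for v
    proof -
      have "v \<in> part_X B \<longleftrightarrow> w \<notin> part_X B" using assms(1) that unfolding bipartite_graph_def by blast
      then show ?thesis by simp
    qed
    then have "lap (edges_XY B) ?f w = 0" unfolding lap_def by (rule sum.neutral[OF ballI])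
    then show "lap (edges_XY B) ?f w = 0 * ?f w" by simp
  qed
qed

lemma signless_spectral_radius_eigenvalue:
  assumes "bipartite_graph B" "part_X B \<union> part_Y B \<noteq> {}"
  shows "lap_eigenvalue B (signless_spectral_radius (graph_of B))"
  unfolding signless_spectral_radius_eq[OF assms(1)]
  using Max_in[OF finite_lap_eigenvalues[OF assms(1)]] lap_eigenvalue_0[OF assms] by auto

lemma signless_spectral_radius_ge:
  assumes "bipartite_graph B" "lap_eigenvalue B \<mu>"
  shows "\<mu> \<le> signless_spectral_radius (graph_of B)"
  unfolding signless_spectral_radius_eq[OF assms(1)]
  using assms by (intro Max_ge finite_lap_eigenvalues) auto

section \<open>Isomorphism with the concrete Q\<close>

lemma digraph_iso_graph_of:
  assumes B: "bipartite_graph B" and h: "inj_on h (part_X B \<union> part_Y B)"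
    and im: "h ` part_X B = part_X B'" "h ` part_Y B = part_Y B'"
    and edges: "map_prod h h ` edges_XY B = edges_XY B'"
  shows "digraph_iso (graph_of B) (graph_of B')"
proof -
  interpret G: graph "graph_of B" by (rule graph_graph_of[OF B])
  let ?f = "\<lparr> iso_verts = h, iso_arcs = map_prod h h, iso_head = snd, iso_tail = fst \<rparr>"
  let ?V = "part_X B \<union> part_Y B" and ?A = "edges_XY B \<union> (edges_XY B)\<inverse>"
  have sub: "?A \<subseteq> ?V \<times> ?V" using B by (auto simp: bipartite_graph_def)
  have "inj_on (map_prod h h) ?A"
    by (rule inj_on_subset[OF map_prod_inj_on[OF h h] sub])
  then have "pre_digraph.digraph_isomorphism (graph_of B) ?f"
    using h G.wf_digraph_axioms by (auto simp: pre_digraph.digraph_isomorphism_def graph_of_def)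
  moreover have "map_prod h h ` ?A = edges_XY B' \<union> (edges_XY B')\<inverse>"
    unfolding edges[symmetric] by force
  then have "graph_of B' = app_iso ?f (graph_of B)"
    using im by (simp add: graph_of_def app_iso_def with_proj_def image_Un)
  ultimately show ?thesis unfolding digraph_iso_def by blast
qed

text \<open>A copy of Q is determined by its four cells, so bijections between cells of equal size
  glue to an isomorphism.\<close>

lemma bij_four_parts:
  assumes "finite X" "finite Y" "X \<inter> Y = {}" "finite X'" "finite Y'" "X' \<inter> Y' = {}"
    and "W \<subseteq> X" "S \<subseteq> Y" "W' \<subseteq> X'" "S' \<subseteq> Y'"
    and "card W = card W'" "card X = card X'" "card S = card S'" "card Y = card Y'"
  obtains h where "inj_on h (X \<union> Y)" "h ` W = W'" "h ` X = X'" "h ` S = S'" "h ` (Y - S) = Y' - S'" "h ` Y = Y'"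
proof -
  have fin: "finite W" "finite S" "finite W'" "finite S'" using assms finite_subset by blast+
  have "card (X - W) = card (X' - W')" "card (Y - S) = card (Y' - S')"
    using assms fin by (simp_all add: card_Diff_subset)
  then obtain h1 h2 h3 h4 where h: "bij_betw h1 W W'" "bij_betw h2 (X - W) (X' - W')"
      "bij_betw h3 S S'" "bij_betw h4 (Y - S) (Y' - S')"
    using assms fin by (meson finite_Diff finite_same_card_bij)
  define h where "h w = (if w \<in> W then h1 w else if w \<in> X then h2 w else if w \<in> S then h3 w else h4 w)" for w
  have c: "bij_betw h W W'" "bij_betw h (X - W) (X' - W')" "bij_betw h S S'" "bij_betw h (Y - S) (Y' - S')"
    using h assms(3,7,8) by (subst bij_betw_cong; (auto simp: h_def)?)+
  have X: "bij_betw h (W \<union> (X - W)) (W' \<union> (X' - W'))" by (rule bij_betw_combine[OF c(1,2)]) auto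
  have Y: "bij_betw h (S \<union> (Y - S)) (S' \<union> (Y' - S'))" by (rule bij_betw_combine[OF c(3,4)]) auto
  have XY: "W \<union> (X - W) = X" "S \<union> (Y - S) = Y" "W' \<union> (X' - W') = X'" "S' \<union> (Y' - S') = Y'"
    using assms(7-10) by auto
  note X = X[unfolded XY] and Y = Y[unfolded XY]
  have "bij_betw h (X \<union> Y) (X' \<union> Y')" by (rule bij_betw_combine[OF X Y assms(6)])
  then show ?thesis using c X Y by (intro that[of h]) (auto simp: bij_betw_def)
qed

text \<open>Across the parts, only \<open>Inr (Inl _)\<close> and \<open>Inr (Inr _)\<close>, the
  two sides of the edgeless factor, are not joined.\<close>

lemma Q_bigraph_simps:
  fixes k n :: nat
  defines "W \<equiv> Inl ` Inl ` {..<k}" and "S \<equiv> Inr ` Inr ` {..<k + 1}"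
  shows "W \<subseteq> part_X (Q_bigraph n k)" "S \<subseteq> part_Y (Q_bigraph n k)" "card W = k" "card S = k + 1"
    "edges_XY (Q_bigraph n k) = Q_edges (part_X (Q_bigraph n k)) (part_Y (Q_bigraph n k)) W S"
    "bipartite_graph (Q_bigraph n k)"
proof -
  show "card W = k" "card S = k + 1" by (simp_all add: W_def S_def card_image)
  show "W \<subseteq> part_X (Q_bigraph n k)" "S \<subseteq> part_Y (Q_bigraph n k)"
    by (auto simp: Q_bigraph_def complete_bigraph_def edgeless_bigraph_def bijoin_def W_def S_def)
  show "edges_XY (Q_bigraph n k) = Q_edges (part_X (Q_bigraph n k)) (part_Y (Q_bigraph n k)) W S"
    unfolding Q_bigraph_def complete_bigraph_def edgeless_bigraph_def bijoin_def W_def S_def Q_edges_def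
    by (auto simp: image_iff)
  show "bipartite_graph (Q_bigraph n k)"
    unfolding Q_bigraph_def complete_bigraph_def edgeless_bigraph_def bijoin_def bipartite_graph_def
    by auto
qed

lemma balanced_parts_Q_bigraph:
  assumes "2 * k + 1 \<le> n"
  shows "balanced_parts (part_X (Q_bigraph n k)) (part_Y (Q_bigraph n k)) n"
proof
  show "finite (part_X (Q_bigraph n k))" "finite (part_Y (Q_bigraph n k))"
      "part_X (Q_bigraph n k) \<inter> part_Y (Q_bigraph n k) = {}"
    using Q_bigraph_simps(6)[of n k] by (simp_all add: bipartite_graph_def)
  have "part_X (Q_bigraph n k) = Inl ` Inl ` {..<k} \<union> Inr ` Inl ` {..<n - k}"
    "part_Y (Q_bigraph n k) = Inl ` Inr ` {..<n - k - 1} \<union> Inr ` Inr ` {..<k + 1}"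
    by (auto simp: Q_bigraph_def complete_bigraph_def edgeless_bigraph_def bijoin_def)
  then show "card (part_X (Q_bigraph n k)) = n" "card (part_Y (Q_bigraph n k)) = n"
    using assms by (simp_all, (subst card_Un_disjoint; auto simp: card_image)+)
qed

lemma Q_bigraph_radius_ge:
  assumes n: "(k + 2)\<^sup>2 \<le> n" and q: "Q_weights k n q a b c d" "2 * real n - k - 1 \<le> q"
  shows "q \<le> signless_spectral_radius (graph_of (Q_bigraph n k))"
proof -
  let ?Q = "Q_bigraph n k"
  let ?W = "Inl ` Inl ` {..<k} :: ((nat + nat) + (nat + nat)) set"
  let ?S = "Inr ` Inr ` {..<k + 1} :: ((nat + nat) + (nat + nat)) set"
  have "2 * k + 1 \<le> n" using n by (simp add: power2_eq_square)
  then interpret balanced_parts "part_X ?Q" "part_Y ?Q" n by (rule balanced_parts_Q_bigraph)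
  interpret Q_parts "part_X ?Q" "part_Y ?Q" n ?W ?S k q a b c d
    by unfold_locales (use Q_bigraph_simps n q in auto)
  have "\<exists>w\<in>part_X ?Q \<union> part_Y ?Q. z w \<noteq> 0" using YS_nonempty z_pos(1) by fastforce
  then have "lap_eigenvalue ?Q q"
    unfolding lap_eigenvalue_def Q_bigraph_simps(5) using lap_z by blast
  then show ?thesis by (rule signless_spectral_radius_ge[OF Q_bigraph_simps(6)])
qed

text \<open>Leaves \<open>graph_of\<close> unchanged, so results stated for shapes with
  \<open>S\<close> in the second part also serve the mirrored case.\<close>

definition bigraph_swap :: "'a bigraph \<Rightarrow> 'a bigraph" where
  "bigraph_swap B = \<lparr> part_X = part_Y B, part_Y = part_X B, edges_XY = (edges_XY B)\<inverse> \<rparr>"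

lemma bigraph_swap_simps [simp]:
  "part_X (bigraph_swap B) = part_Y B" "part_Y (bigraph_swap B) = part_X B"
  "edges_XY (bigraph_swap B) = (edges_XY B)\<inverse>" "graph_of (bigraph_swap B) = graph_of B"
  "bipartite_graph (bigraph_swap B) \<longleftrightarrow> bipartite_graph B"
  by (auto simp: bigraph_swap_def graph_of_def bipartite_graph_def Un_commute)

lemma subeigenvector:
  assumes "lap_eigenvalue B \<mu>" "0 \<le> \<mu>"
  obtains g u where "\<And>w. 0 \<le> g w" "u \<in> part_X B \<union> part_Y B" "g u \<noteq> 0"
    "\<And>w. w \<in> part_X B \<union> part_Y B \<Longrightarrow> \<mu> * g w \<le> lap (edges_XY B) g w"
proof -
  obtain f u where f: "u \<in> part_X B \<union> part_Y B" "f u \<noteq> 0"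
    "\<And>w. w \<in> part_X B \<union> part_Y B \<Longrightarrow> lap (edges_XY B) f w = \<mu> * f w"
    using assms(1) unfolding lap_eigenvalue_def by blast
  show ?thesis
  proof
    show "\<mu> * \<bar>f w\<bar> \<le> lap (edges_XY B) (\<lambda>v. \<bar>f v\<bar>) w" if "w \<in> part_X B \<union> part_Y B" for w
      by (rule lap_abs[OF f(3)[OF that] assms(2)])
  qed (use f in auto)
qed

text \<open>The shape embeds the graph in a copy of Q on its own vertices; the radius hypothesis and
  \<open>Q_unique\<close> make the inclusion an equality, and the cells are then matched.\<close>

lemma Q_shape_iso:
  assumes B: "bipartite_graph B" and card: "card (part_X B) = n" "card (part_Y B) = n"
    and n: "(k + 2)\<^sup>2 \<le> n" and shape: "Q_shape k (part_X B) (part_Y B) (edges_XY B)"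
    and radius: "signless_spectral_radius (graph_of (Q_bigraph n k)) \<le> signless_spectral_radius (graph_of B)"
  shows "digraph_iso (graph_of B) (graph_of (Q_bigraph n k))"
proof -
  let ?Q = "Q_bigraph n k" and ?\<mu> = "signless_spectral_radius (graph_of B)"
  interpret balanced_parts "part_X B" "part_Y B" n
    using B card by unfold_locales (auto simp: bipartite_graph_def)
  obtain q a b c d where w: "Q_weights k n q a b c d" "2 * real n - k - 1 \<le> q"
    using Q_weights_exist[OF n] by metis
  obtain W S where WS: "W \<subseteq> part_X B" "S \<subseteq> part_Y B" "card W = k" "card S = k + 1"
    "edges_XY B \<subseteq> Q_edges (part_X B) (part_Y B) W S"
    using shape unfolding Q_shape_def Q_edges_def by blast
  interpret Q_parts "part_X B" "part_Y B" n W S k q a b c d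
    by unfold_locales (use WS n w in auto)
  have q_le: "q \<le> ?\<mu>" using Q_bigraph_radius_ge[OF n w] radius by simp
  have ne: "part_X B \<union> part_Y B \<noteq> {}" using YS_nonempty by blast
  have mu: "0 \<le> ?\<mu>" using q_le q_gt by simp
  obtain g u where g: "\<And>w. 0 \<le> g w" "u \<in> part_X B \<union> part_Y B" "g u \<noteq> 0"
    "\<And>w. w \<in> part_X B \<union> part_Y B \<Longrightarrow> ?\<mu> * g w \<le> lap (edges_XY B) g w"
    by (rule subeigenvector[OF signless_spectral_radius_eigenvalue[OF B ne] mu]) (rule that)
  have edges: "edges_XY B = Q_edges (part_X B) (part_Y B) W S"
    by (rule Q_unique[where g = g, OF WS(5) g(1,4,2,3) q_le])
  let ?W = "Inl ` Inl ` {..<k} :: ((nat + nat) + (nat + nat)) set"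
  let ?S = "Inr ` Inr ` {..<k + 1} :: ((nat + nat) + (nat + nat)) set"
  have "2 * k + 1 \<le> n" using nk by simp
  then interpret Q: balanced_parts "part_X ?Q" "part_Y ?Q" n by (rule balanced_parts_Q_bigraph)
  obtain h where h: "inj_on h (part_X B \<union> part_Y B)" "h ` W = ?W" "h ` part_X B = part_X ?Q" "h ` S = ?S"
      "h ` (part_Y B - S) = part_Y ?Q - ?S" "h ` part_Y B = part_Y ?Q"
    by (rule bij_four_parts[OF fin disj Q.fin Q.disj WS(1,2) Q_bigraph_simps(1,2)[of k n]])
      (use WS card Q.card_parts Q_bigraph_simps(3,4) in auto)
  have "map_prod h h ` edges_XY B = edges_XY ?Q"
    unfolding edges Q_bigraph_simps(5) Q_edges_def image_Un map_prod_surj_on[OF h(3,5)] map_prod_surj_on[OF h(2,4)] ..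
  then show ?thesis by (rule digraph_iso_graph_of[OF B h(1,3,6)])
qed

lemma R_shape_radius:
  assumes B: "bipartite_graph B" and card: "card (part_X B) = n" "card (part_Y B) = n"
    and n: "9 \<le> n" and shape: "R_shape (part_X B) (part_Y B) (edges_XY B)"
  shows "signless_spectral_radius (graph_of B) < signless_spectral_radius (graph_of (Q_bigraph n 1))"
proof (rule ccontr)
  assume "\<not> ?thesis"
  then have radius: "signless_spectral_radius (graph_of (Q_bigraph n 1)) \<le> signless_spectral_radius (graph_of B)"
    by simp
  let ?X = "part_X B" and ?Y = "part_Y B" and ?\<mu> = "signless_spectral_radius (graph_of B)"
  interpret balanced_parts ?X ?Y n
    using B card by unfold_locales (auto simp: bipartite_graph_def)
  have n': "(1 + 2)\<^sup>2 \<le> n" using n by (simp add: power2_eq_square)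
  obtain q a b c d where w: "Q_weights 1 n q a b c d" "2 * real n - real 1 - 1 \<le> q"
    using Q_weights_exist[OF n'] by metis
  have q_le: "q \<le> ?\<mu>" using Q_bigraph_radius_ge[OF n' w] radius by simp
  have mu: "0 \<le> ?\<mu>" using q_le w(2) n by simp
  have ne: "?X \<union> ?Y \<noteq> {}" using card n by auto
  obtain g u where g: "\<And>w. 0 \<le> g w" "u \<in> ?X \<union> ?Y" "g u \<noteq> 0"
    "\<And>w. w \<in> ?X \<union> ?Y \<Longrightarrow> ?\<mu> * g w \<le> lap (edges_XY B) g w"
    by (rule subeigenvector[OF signless_spectral_radius_eigenvalue[OF B ne] mu]) (rule that)
  obtain s1 s2 p1 p2 where R: "{s1, s2} \<subseteq> ?Y" "s1 \<noteq> s2" "{p1, p2} \<subseteq> ?X" "p1 \<noteq> p2"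
    "edges_XY B \<subseteq> ?X \<times> (?Y - {s1, s2}) \<union> {(p1, s1), (p2, s2)}"
    using shape unfolding R_shape_def by blast
  \<comment> \<open>The copy of Q used for comparison depends on \<open>g\<close>: its cell of size
    1 is whichever of the two neighbours has the larger value. The shape is symmetric in its two
    pendant edges.\<close>
  have no: False if "{s1, s2} \<subseteq> ?Y" "s1 \<noteq> s2" "{p1, p2} \<subseteq> ?X" "p1 \<noteq> p2" "g p2 \<le> g p1"
    "edges_XY B \<subseteq> ?X \<times> (?Y - {s1, s2}) \<union> {(p1, s1), (p2, s2)}" for s1 s2 p1 p2
  proof -
    interpret Q_parts ?X ?Y n "{p1}" "{s1, s2}" 1 q a b c d
      by unfold_locales (use that n' w in auto)
    let ?R = "?X \<times> (?Y - {s1, s2}) \<union> {(p1, s1), (p2, s2)}"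
    have "?R \<subseteq> ?X \<times> ?Y" using that by auto
    then have "?\<mu> * g w \<le> lap ?R g w" if "w \<in> ?X \<union> ?Y" for w
      using g(4)[OF that] lap_mono[where g = g, OF \<open>edges_XY B \<subseteq> ?R\<close> _ g(1)] by (meson order_trans)
    then show False
      using R_impossible_ordered[of p1 s1 s2 p2 g ?\<mu> u] that g q_le by blast
  qed
  show False
  proof (cases "g p2 \<le> g p1")
    case True
    then show ?thesis using no[of s1 s2 p1 p2] R by blast
  next
    case False
    then show ?thesis using no[of s2 s1 p2 p1] R by (auto simp: insert_commute)
  qed
qed

theorem theorem2p2:
  fixes k n :: nat and G :: "'a bigraph"
  assumes "n \<ge> (k + 2)^2"
    and "bipartite_graph G" and "balanced G" and "card (verts (graph_of G)) = 2 * n"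
    and "min_degree (graph_of G) \<ge> k"
    and "signless_spectral_radius (graph_of G)
           \<ge> signless_spectral_radius (graph_of (Q_bigraph n k))"
  shows "traceable (graph_of G) \<or> digraph_iso (graph_of G) (graph_of (Q_bigraph n k))"
proof (rule disjCI)
  assume not_iso: "\<not> digraph_iso (graph_of G) (graph_of (Q_bigraph n k))"
  let ?X = "part_X G" and ?Y = "part_Y G" and ?E = "edges_XY G"
  let ?\<mu> = "signless_spectral_radius (graph_of G)"
  note n = assms(1) and B = assms(2) and radius = assms(6)
  have "card (?X \<union> ?Y) = card ?X + card ?Y"
    using B by (intro card_Un_disjoint) (auto simp: bipartite_graph_def)
  then have card: "card ?X = n" "card ?Y = n" using assms(3,4) by (simp_all add: balanced_def)
  interpret balanced_parts ?X ?Y n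
    using B card by unfold_locales (auto simp: bipartite_graph_def)
  have E: "?E \<subseteq> ?X \<times> ?Y" using B by (simp add: bipartite_graph_def)
  have nk: "4 * k + 4 \<le> n" using n by (simp add: power2_eq_square algebra_simps)
  have ne: "?X \<union> ?Y \<noteq> {}" using card nk by auto
  have deg: "k \<le> card ((?E \<union> ?E\<inverse>) `` {w})" if "w \<in> ?X \<union> ?Y" for w
  proof -
    have "min_degree (graph_of G) \<le> out_degree (graph_of G) w"
      unfolding min_degree_def by (rule Min_le) (use that in auto)
    then show ?thesis using assms(5) by (simp add: out_degree_graph_of)
  qed
  have nb: "x \<in> ?X \<Longrightarrow> (?E \<union> ?E\<inverse>) `` {x} = ?E `` {x}" "y \<in> ?Y \<Longrightarrow> (?E \<union> ?E\<inverse>) `` {y} = ?E\<inverse> `` {y}" for x y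
    using E disj by auto
  obtain q a b c d where w: "Q_weights k n q a b c d" "2 * real n - k - 1 \<le> q"
    "1 \<le> k \<Longrightarrow> 2 * real n - k - 1 < q"
    using Q_weights_exist[OF n] by metis
  have q_le: "q \<le> ?\<mu>" using Q_bigraph_radius_ge[OF n w(1,2)] radius by simp
  have mu: "0 < ?\<mu>" using q_le w(2) nk by linarith
  obtain f u where f: "u \<in> ?X \<union> ?Y" "f u \<noteq> 0" "\<And>w. w \<in> ?X \<union> ?Y \<Longrightarrow> lap ?E f w = ?\<mu> * f w"
    using signless_spectral_radius_eigenvalue[OF B ne] unfolding lap_eigenvalue_def by blast
  have edges: "?\<mu> * n \<le> card ?E + real n * n" by (rule eigenvalue_le_edges[OF E f(3,1,2) mu])
  have N: "0 < real n" using nk by simp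
  \<comment> \<open>Against \<open>edges\<close>, the lower bound \<open>2 * n - k - 1\<close> for
    the radius becomes the budget of \<open>n * (k + 1)\<close> missing edges.\<close>
  have "(2 * real n - k - 1) * n \<le> ?\<mu> * n"
    using w(2) q_le N by (intro mult_right_mono) auto
  then have "real (n * n) \<le> real (card ?E + n * (k + 1))" using edges by (simp add: algebra_simps)
  then have e1: "n * n \<le> card ?E + n * (k + 1)" by (simp only: of_nat_le_iff)
  have e2: "n * n < card ?E + n * (k + 1)" if "1 \<le> k"
  proof -
    have "(2 * real n - k - 1) * n < ?\<mu> * n"
      using w(3)[OF that] q_le N by (intro mult_strict_right_mono) auto
    then have "real (n * n) < real (card ?E + n * (k + 1))" using edges by (simp add: algebra_simps)
    then show ?thesis by (simp only: of_nat_less_iff)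
  qed
  show "traceable (graph_of G)"
  proof (rule ccontr)
    assume "\<not> traceable (graph_of G)"
    then have ns: "\<not> spanned (?X \<union> ?Y) ?E" using traceable_graph_of ne by blast
    have "Q_shape k ?X ?Y ?E \<or> Q_shape k ?Y ?X (?E\<inverse>) \<or> k = 1 \<and> (R_shape ?X ?Y ?E \<or> R_shape ?Y ?X (?E\<inverse>) \<or>
        (\<forall>x\<in>?X. card (?E `` {x}) < n) \<and> (\<forall>y\<in>?Y. card (?E\<inverse> `` {y}) < n))"
      by (rule stability[OF E ns _ _ n e1 e2]) (use deg nb in fastforce)+
    then consider "Q_shape k ?X ?Y ?E" | "Q_shape k ?Y ?X (?E\<inverse>)" | "k = 1" "R_shape ?X ?Y ?E"
      | "k = 1" "R_shape ?Y ?X (?E\<inverse>)"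
      | "k = 1" "\<forall>x\<in>?X. card (?E `` {x}) < n" "\<forall>y\<in>?Y. card (?E\<inverse> `` {y}) < n"
      by blast
    then show False
    proof cases
      case 1
      then show ?thesis using Q_shape_iso[OF B card n _ radius] not_iso by blast
    next
      case 2
      then show ?thesis using Q_shape_iso[of "bigraph_swap G" n k] B card n radius not_iso by simp
    next
      case 3
      then show ?thesis using R_shape_radius[OF B card] n radius by (simp add: power2_eq_square)
    next
      case 4
      then show ?thesis using R_shape_radius[of "bigraph_swap G" n] B card n radius by (simp add: power2_eq_square)
    next
      case 5
      have "card ((?E \<union> ?E\<inverse>) `` {w}) < n" if "w \<in> ?X \<union> ?Y" for w
        using that 5(2,3) nb by (metis UnE)
      then have "card ((?E \<union> ?E\<inverse>) `` {w}) \<le> n - 1" if "w \<in> ?X \<union> ?Y" for w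
        using that by fastforce
      then have "?\<mu> \<le> 2 * real (n - 1)"
        by (intro eigenvalue_le_twice_degree[OF E f(3,1,2)]) (use mu in auto)
      then show ?thesis using w(3) q_le 5(1) nk by (simp add: of_nat_diff)
    qed
  qed
qed

end
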